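(* For every $\varepsilon\in(0,1/3)$ there is a randomized algorithm which, for the problem of maximizing a non-negative (possibly non-monotone) submodular function $f$ on an $n$-element ground set subject to a knapsack constraint $c(T)\le B$, achieves a $(9.465+\varepsilon)$-approximation using $O(\frac{1}{\varepsilon}\log^2 n)$ adaptive rounds and $O(\frac{n}{\varepsilon^3}\log^3 n\,\log\frac{1}{\varepsilon})$ value queries.
   Context: Problem setting: $\mathcal{N}$ is a finite ground set with $|\mathcal{N}|=n$; $f:2^{\mathcal{N}}\to\mathbb{R}$ is non-negative and submodular (not necessarily monotone), i.e. $f(S)\ge0$ and $f(S\cup\{x\})-f(S)\ge f(T\cup\{x\})-f(T)$ for all $S\subseteq T$, $x\notin T$. A cost function $c:\mathcal{N}\to\mathbb{R}_{>0}$ is extended additively, $c(S)=\sum_{x\in S}c(x)$, and $B>0$ is a budget, with $\max_{x}c(x)\le B$ assumed throughout. Let $OPT=\max\{f(T): c(T)\le B\}$; a randomized algorithm is a $\beta$-approximation if $\beta\cdot\mathbb{E}[f(\text{output})]\ge OPT$ and its output always satisfies the constraint. The function $f$ is accessed only through a value oracle returning $f(S)$; query complexity is the total number of oracle calls, and adaptive complexity is the number of sequential rounds, where in each round polynomially many queries are issued in parallel and may depend only on answers from earlier rounds. *)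

theory Defs
  imports "HOL-Probability.Probability"
begin

definition submodular_on :: "'a set \<Rightarrow> ('a set \<Rightarrow> real) \<Rightarrow> bool" where
  "submodular_on N f \<longleftrightarrow>
     (\<forall>S T x. S \<subseteq> T \<longrightarrow> T \<subseteq> N \<longrightarrow> x \<in> N \<longrightarrow> x \<notin> T \<longrightarrow>
        f (S \<union> {x}) - f S \<ge> f (T \<union> {x}) - f T)"

definition knapsack_instance :: "'a set \<Rightarrow> ('a \<Rightarrow> real) \<Rightarrow> real \<Rightarrow> ('a set \<Rightarrow> real) \<Rightarrow> bool" where
  "knapsack_instance N c B f \<longleftrightarrow>
     finite N \<and> (\<forall>S. S \<subseteq> N \<longrightarrow> 0 \<le> f S) \<and> submodular_on N f \<and>
     0 < B \<and> (\<forall>x\<in>N. 0 < c x \<and> c x \<le> B)"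

definition feasible :: "'a set \<Rightarrow> ('a \<Rightarrow> real) \<Rightarrow> real \<Rightarrow> 'a set \<Rightarrow> bool" where
  "feasible N c B T \<longleftrightarrow> T \<subseteq> N \<and> (\<Sum>x\<in>T. c x) \<le> B"

definition OPT :: "'a set \<Rightarrow> ('a \<Rightarrow> real) \<Rightarrow> real \<Rightarrow> ('a set \<Rightarrow> real) \<Rightarrow> real" where
  "OPT N c B f = Max (f ` {T. feasible N c B T})"

text \<open>
  Randomized algorithms with access to a value oracle. \<open>Toss p\<close> draws the rest of the algorithm
  from \<open>p\<close>. \<open>Round qs k\<close> is one adaptive round: the queries \<open>qs\<close> are issued in parallel, and the
  list of their answers is handed to \<open>k\<close>. Only the answers to these queries give
  information about the objective function.
\<close>
datatype 'a oracle_alg =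
    Output "'a set"
  | Toss "'a oracle_alg pmf"
  | Round "'a set list" "real list \<Rightarrow> 'a oracle_alg"

text \<open>
  Joint distribution of the output and of the transcript, that is the list of the rounds
  executed, each given by the list of its queries.
\<close>
primrec run :: "('a set \<Rightarrow> real) \<Rightarrow> 'a oracle_alg \<Rightarrow> ('a set \<times> 'a set list list) pmf" where
  "run f (Output S) = return_pmf (S, [])"
| "run f (Toss p) = join_pmf (map_pmf (run f) p)"
| "run f (Round qs k) = map_pmf (\<lambda>(S, tr). (S, qs # tr)) (run f (k (map f qs)))"

definition adaptive_rounds :: "'a set list list \<Rightarrow> nat" where
  "adaptive_rounds tr = length tr"

definition value_queries :: "'a set list list \<Rightarrow> nat" where
  "value_queries tr = sum_list (map length tr)"

definition valid_transcript :: "'a set \<Rightarrow> 'a set list list \<Rightarrow> bool" where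
  "valid_transcript N tr \<longleftrightarrow> (\<forall>qs \<in> set tr. \<forall>S \<in> set qs. S \<subseteq> N)"

definition approximates ::
  "real \<Rightarrow> 'a set \<Rightarrow> ('a \<Rightarrow> real) \<Rightarrow> real \<Rightarrow> ('a set \<Rightarrow> real) \<Rightarrow> 'a oracle_alg \<Rightarrow> bool" where
  "approximates \<beta> N c B f A \<longleftrightarrow>
     (\<forall>(S, tr) \<in> set_pmf (run f A). feasible N c B S) \<and>
     \<beta> * measure_pmf.expectation (run f A) (\<lambda>(S, tr). f S) \<ge> OPT N c B f"

end

theory Submission imports Defs begin

text \<open>
  The ratio 9.465 leaves enough room for an algorithm with fixed parameters, independent of
  \<open>\<epsilon>\<close>, that uses \<open>O(log n)\<close> rounds and \<open>O(n log\<^sup>2 n)\<close> queries.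

  Every element independently draws a random epoch, or with probability \<open>2/3\<close> never arrives. In
  each epoch, all arriving elements that fit into the remaining budget and have marginal density
  at least \<open>\<tau>\<close> with respect to the current set are added at once. The epochs grow by a factor
  \<open>1 + 1/1000\<close>, so an element is much more likely to arrive before the epoch in which it stops
  being addable than in that very epoch. Hence in expectation only a small part of the selected
  cost is bad, meaning that it fails the test against the other elements of its epoch, and the
  remaining elements form a feasible set of density \<open>\<tau>\<close>.

  Let \<open>V\<close> be optimal, \<open>v\<close> its costliest element and \<open>\<Gamma> = B - c w\<close> for the second costliest
  element \<open>w\<close>. If the selected cost exceeds \<open>\<Gamma>\<close> with probability at least \<open>1/50\<close>, then one
  of 128 independent copies yields about \<open>\<tau> \<Gamma>\<close>. Otherwise all elements of \<open>V - {v}\<close> almost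
  always fit. Those that arrived and were rejected contribute at most \<open>\<tau> \<Gamma>\<close>, \<open>v\<close> at most
  \<open>f {v}\<close>, and those that never arrived at most twice the expected value of the kept elements,
  because they would have been kept with probability \<open>1/3\<close>. Since no element is selected with
  probability above \<open>1/3\<close>, submodularity gives \<open>E f(V \<union> S) \<ge> 2/3 f V\<close>. A geometric grid of
  thresholds, scaled by the best singleton, contains one with \<open>4/25 f V \<le> \<tau> \<Gamma> \<le> 1/5 f V\<close>,
  which balances the two cases.
\<close>

subsection \<open>Submodular functions\<close>

lemma submodular_onD:
  assumes "submodular_on N f" "S \<subseteq> T" "T \<subseteq> N" "x \<in> N" "x \<notin> T"
  shows "f (insert x T) - f T \<le> f (insert x S) - f S"
  using assms unfolding submodular_on_def by (metis Un_insert_right sup_bot.right_neutral)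

lemma submodular_union_upper:
  assumes "submodular_on N f" "finite A" "A \<subseteq> N" "S \<subseteq> N" "A \<inter> S = {}"
  shows "f (S \<union> A) - f S \<le> (\<Sum>x\<in>A. f (insert x S) - f S)"
  using assms(2,3,5)
proof (induction A rule: finite_induct)
  case (insert x A)
  have "f (insert x (S \<union> A)) - f (S \<union> A) \<le> f (insert x S) - f S"
    using insert assms by (intro submodular_onD[OF assms(1)]) auto
  with insert show ?case by auto
qed auto

text \<open>Within \<open>T\<close> the marginal of \<open>x\<close> is smallest with respect to
  \<open>T - {x}\<close>, so adding \<open>A\<close> element by element gains at least these last
  marginals.\<close>

lemma submodular_union_lower:
  assumes "submodular_on N f" "finite A" "A \<inter> U = {}" "U \<union> A \<subseteq> T" "T \<subseteq> N"
  shows "f U + (\<Sum>x\<in>A. f T - f (T - {x})) \<le> f (U \<union> A)"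
  using assms(2-4)
proof (induction A rule: finite_induct)
  case (insert x A)
  have "f (insert x (T - {x})) - f (T - {x}) \<le> f (insert x (U \<union> A)) - f (U \<union> A)"
    using insert assms(5) by (intro submodular_onD[OF assms(1)]) auto
  moreover have "insert x (T - {x}) = T" using insert by auto
  ultimately show ?case using insert by auto
qed auto

text \<open>This lets the sampling lemma below be applied to \<open>f (V \<union> R)\<close> with
  \<open>V\<close> optimal and \<open>R\<close> random.\<close>

lemma submodular_on_union_left:
  assumes "submodular_on N f" "V \<subseteq> N"
  shows "submodular_on N (\<lambda>S. f (V \<union> S))"
  unfolding submodular_on_def
proof (intro allI impI)
  fix S T x assume *: "S \<subseteq> T" "T \<subseteq> N" "x \<in> N" "x \<notin> T"
  show "f (V \<union> (S \<union> {x})) - f (V \<union> S) \<ge> f (V \<union> (T \<union> {x})) - f (V \<union> T)"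
  proof (cases "x \<in> V")
    case True
    then have "V \<union> (S \<union> {x}) = V \<union> S" "V \<union> (T \<union> {x}) = V \<union> T" by auto
    then show ?thesis by simp
  next
    case False
    then show ?thesis
      using submodular_onD[OF assms(1), of "V \<union> S" "V \<union> T" x] * assms(2) by auto
  qed
qed

text \<open>
  The elements are removed in order of increasing probability, so that the nonnegative term
  \<open>q * g A\<close> absorbs every marginal of \<open>g\<close>.
\<close>
lemma expectation_random_subset_aux:
  fixes R :: "'w \<Rightarrow> 'a set"
  assumes sub: "submodular_on N g" and nonneg: "\<And>S. S \<subseteq> N \<Longrightarrow> 0 \<le> g S"
    and fin: "finite (set_pmf P)"
    and prob: "\<And>x. x \<in> N \<Longrightarrow> measure_pmf.prob P {w. x \<in> R w} \<le> p"
    and "finite A" "A \<subseteq> N" "q \<le> p" "\<And>x. x \<in> A \<Longrightarrow> q \<le> measure_pmf.prob P {w. x \<in> R w}"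
  shows "(1 - p) * g {} + q * g A \<le> measure_pmf.expectation P (\<lambda>w. g (R w \<inter> A))"
  using assms(5-)
proof (induction "card A" arbitrary: A q)
  case 0
  then have "A = {}" by simp
  have "(q - p) * g {} \<le> 0" using 0 nonneg by (simp add: mult_nonpos_nonneg)
  then show ?case using \<open>A = {}\<close> by (simp add: algebra_simps)
next
  case (Suc m)
  let ?pr = "\<lambda>x. measure_pmf.prob P {w. x \<in> R w}"
  have int: "integrable P h" for h :: "'w \<Rightarrow> real"
    by (rule integrable_measure_pmf_finite[OF fin])
  have "A \<noteq> {}" using Suc by auto
  then have "Min (?pr ` A) \<in> ?pr ` A" using Suc.prems(1) by (intro Min_in) auto
  then obtain x where "x \<in> A" and x_min: "?pr x = Min (?pr ` A)" by auto
  then have x: "x \<in> A" "?pr x \<le> ?pr y" if "y \<in> A" for y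
    unfolding x_min using Suc.prems(1) that by (auto intro: Min_le)
  define A' where "A' = A - {x}"
  have A: "A = insert x A'" "x \<notin> A'" "finite A'" "A' \<subseteq> N" "x \<in> N" "card A' = m"
    using \<open>x \<in> A\<close> Suc unfolding A'_def by auto
  have IH: "(1 - p) * g {} + ?pr x * g A' \<le> measure_pmf.expectation P (\<lambda>w. g (R w \<inter> A'))"
    using A x prob by (intro Suc.hyps) auto
  \<comment> \<open>If \<open>x\<close> is drawn, its marginal over the drawn part of
    \<open>A'\<close> is at least its marginal over all of \<open>A'\<close>.\<close>
  have "g (R w \<inter> A') + indicator {w. x \<in> R w} w * (g A - g A') \<le> g (R w \<inter> A)" for w
  proof (cases "x \<in> R w")
    case True
    then have "R w \<inter> A = insert x (R w \<inter> A')" using A by auto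
    then show ?thesis using submodular_onD[OF sub, of "R w \<inter> A'" A' x] A True by simp
  next
    case False
    then have "R w \<inter> A = R w \<inter> A'" using A by auto
    then show ?thesis using False by simp
  qed
  then have "measure_pmf.expectation P
      (\<lambda>w. g (R w \<inter> A') + indicator {w. x \<in> R w} w * (g A - g A'))
    \<le> measure_pmf.expectation P (\<lambda>w. g (R w \<inter> A))"
    by (intro integral_mono int) auto
  then have "measure_pmf.expectation P (\<lambda>w. g (R w \<inter> A')) + ?pr x * (g A - g A')
    \<le> measure_pmf.expectation P (\<lambda>w. g (R w \<inter> A))"
    by (subst (asm) Bochner_Integration.integral_add[OF int int]) simp
  \<comment> \<open>The term \<open>?pr x * g A'\<close> of \<open>IH\<close> cancels the negative
    part of the marginal.\<close>
  with IH have "(1 - p) * g {} + ?pr x * g A \<le> measure_pmf.expectation P (\<lambda>w. g (R w \<inter> A))"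
    by (simp add: algebra_simps)
  moreover have "q * g A \<le> ?pr x * g A"
    using Suc.prems \<open>x \<in> A\<close> nonneg by (intro mult_right_mono) auto
  ultimately show ?case by linarith
qed

text \<open>The sampling lemma of non-monotone submodular maximization; the memberships may depend
  on each other. It is the case \<open>q = 0\<close>, \<open>A = N\<close> of the previous
  lemma.\<close>

lemma expectation_random_subset:
  assumes "submodular_on N g" "\<And>S. S \<subseteq> N \<Longrightarrow> 0 \<le> g S" "finite N"
    and "finite (set_pmf P)" "0 \<le> p"
    and "\<And>x. x \<in> N \<Longrightarrow> measure_pmf.prob P {w. x \<in> R w} \<le> p"
    and "\<And>w. R w \<subseteq> N"
  shows "(1 - p) * g {} \<le> measure_pmf.expectation P (\<lambda>w. g (R w))"
proof -
  have "R w \<inter> N = R w" for w using assms(7) by auto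
  then show ?thesis
    using expectation_random_subset_aux[OF assms(1,2,4,6) assms(3) subset_refl assms(5)] by simp
qed

subsection \<open>The random-epoch process\<close>

definition addable ::
  "('a \<Rightarrow> real) \<Rightarrow> real \<Rightarrow> ('a set \<Rightarrow> real) \<Rightarrow> real \<Rightarrow> 'a set \<Rightarrow> 'a \<Rightarrow> bool" where
  "addable c B f \<tau> S x \<longleftrightarrow> sum c S + c x \<le> B \<and> \<tau> * c x \<le> f (insert x S) - f S"

text \<open>All elements of an epoch are tested against the set at its start, so one round of
  queries settles the epoch, but together they may exceed the budget. In the process of length
  \<open>K\<close>, an epoch value of at least \<open>K\<close> means that the element never
  arrives.\<close>

primrec sel ::
  "'a set \<Rightarrow> ('a \<Rightarrow> real) \<Rightarrow> real \<Rightarrow> ('a set \<Rightarrow> real) \<Rightarrow> real \<Rightarrow> ('a \<Rightarrow> nat) \<Rightarrow> nat \<Rightarrow> 'a set" where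
  "sel N c B f \<tau> \<omega> 0 = {}"
| "sel N c B f \<tau> \<omega> (Suc k) = sel N c B f \<tau> \<omega> k \<union>
     {x \<in> N. \<omega> x = k \<and> addable c B f \<tau> (sel N c B f \<tau> \<omega> k) x}"

text \<open>
  The elements that are still addable after the other elements of their own epoch have been added.
  When an epoch exceeds the budget, none of its elements is kept.
\<close>
definition kept ::
  "'a set \<Rightarrow> ('a \<Rightarrow> real) \<Rightarrow> real \<Rightarrow> ('a set \<Rightarrow> real) \<Rightarrow> real \<Rightarrow> nat \<Rightarrow> ('a \<Rightarrow> nat) \<Rightarrow> 'a set" where
  "kept N c B f \<tau> K \<omega> =
     {x \<in> sel N c B f \<tau> \<omega> K. addable c B f \<tau> (sel N c B f \<tau> \<omega> (Suc (\<omega> x)) - {x}) x}"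

lemma sel_iff:
  "x \<in> sel N c B f \<tau> \<omega> k \<longleftrightarrow>
     x \<in> N \<and> \<omega> x < k \<and> addable c B f \<tau> (sel N c B f \<tau> \<omega> (\<omega> x)) x"
  by (induction k) (auto simp: less_Suc_eq)

lemma sel_subset: "sel N c B f \<tau> \<omega> k \<subseteq> N"
  by (auto simp: sel_iff)

lemma sel_mono: "k \<le> l \<Longrightarrow> sel N c B f \<tau> \<omega> k \<subseteq> sel N c B f \<tau> \<omega> l"
  by (auto simp: sel_iff)

lemma kept_subset: "kept N c B f \<tau> K \<omega> \<subseteq> sel N c B f \<tau> \<omega> K"
  by (auto simp: kept_def)

text \<open>The first \<open>k\<close> epochs only notice elements arriving in them, and
  \<open>x\<close> does not do so before or after the change.\<close>

lemma sel_fun_upd: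
  assumes "k \<le> \<omega> x" "k \<le> y"
  shows "sel N c B f \<tau> (fun_upd \<omega> x y) k = sel N c B f \<tau> \<omega> k"
  using assms by (induction k) auto

text \<open>Elements of one epoch do not see each other, so moving \<open>x\<close> forward to epoch
  \<open>y\<close> can change the set after that epoch by \<open>x\<close> alone.\<close>

lemma sel_Suc_fun_upd:
  assumes "y < \<omega> x"
  shows "sel N c B f \<tau> (fun_upd \<omega> x y) (Suc y) - {x} = sel N c B f \<tau> \<omega> (Suc y)"
proof -
  have "x \<notin> sel N c B f \<tau> \<omega> (Suc y)" using assms by (auto simp: sel_iff)
  moreover have "sel N c B f \<tau> (fun_upd \<omega> x y) y = sel N c B f \<tau> \<omega> y"
    using assms by (intro sel_fun_upd) auto
  ultimately show ?thesis using assms by auto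
qed

declare sel.simps(2) [simp del]

section \<open>Feasibility and density of the kept elements\<close>

locale knapsack_process =
  fixes N :: "'a set" and c :: "'a \<Rightarrow> real" and B :: real and f :: "'a set \<Rightarrow> real"
    and \<tau> :: real and K :: nat
  assumes inst: "knapsack_instance N c B f" and tau_nonneg: "0 \<le> \<tau>"
begin

lemma finN: "finite N" and f_nonneg: "S \<subseteq> N \<Longrightarrow> 0 \<le> f S" and submod: "submodular_on N f"
  and B_pos: "0 < B" and c_pos: "x \<in> N \<Longrightarrow> 0 < c x" and c_le: "x \<in> N \<Longrightarrow> c x \<le> B"
  using inst by (auto simp: knapsack_instance_def)

abbreviation "add \<equiv> addable c B f \<tau>"
abbreviation "S \<equiv> sel N c B f \<tau>"
abbreviation "G \<equiv> kept N c B f \<tau> K"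

lemma fin_sub: "A \<subseteq> N \<Longrightarrow> finite A"
  using finN finite_subset by auto

lemma cost_mono: "A \<subseteq> A' \<Longrightarrow> A' \<subseteq> N \<Longrightarrow> sum c A \<le> sum c A'"
  by (intro sum_mono2 fin_sub) (auto intro: less_imp_le c_pos)

lemma cost_nonneg: "A \<subseteq> N \<Longrightarrow> 0 \<le> sum c A"
  by (intro sum_nonneg) (auto intro: less_imp_le c_pos)

text \<open>A larger set costs more and leaves a smaller marginal, so both tests only get
  harder.\<close>

lemma add_antimono:
  assumes "A \<subseteq> A'" "A' \<subseteq> N" "x \<in> N" "x \<notin> A'" "add A' x"
  shows "add A x"
  using assms submodular_onD[OF submod, of A A' x] cost_mono[of A A']
  unfolding addable_def by linarith

lemma add_sel_antimono:
  "k \<le> l \<Longrightarrow> x \<in> N \<Longrightarrow> x \<notin> S \<omega> l \<Longrightarrow> add (S \<omega> l) x \<Longrightarrow> add (S \<omega> k) x"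
  by (rule add_antimono[OF sel_mono sel_subset])

text \<open>A kept element of the latest epoch fits on top of everything else selected up to the end
  of that epoch, and this set contains \<open>G \<omega>\<close>.\<close>

lemma kept_feasible: "feasible N c B (G \<omega>)"
proof (cases "G \<omega> = {}")
  case True
  then show ?thesis using B_pos by (simp add: feasible_def)
next
  case False
  have sub: "G \<omega> \<subseteq> N" using kept_subset sel_subset by (metis subset_trans)
  have "Max (\<omega> ` G \<omega>) \<in> \<omega> ` G \<omega>" using False fin_sub[OF sub] by (intro Max_in) auto
  then obtain x where x: "x \<in> G \<omega>" "\<omega> x = Max (\<omega> ` G \<omega>)" by auto
  have max: "\<omega> y \<le> \<omega> x" if "y \<in> G \<omega>" for y
    unfolding x(2) using that fin_sub[OF sub] by (intro Max_ge) auto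
  let ?T = "S \<omega> (Suc (\<omega> x))"
  have xT: "x \<in> ?T" using x(1) unfolding kept_def sel_iff by simp
  have "G \<omega> \<subseteq> ?T" using max by (auto simp: kept_def sel_iff le_imp_less_Suc)
  then have "sum c (G \<omega>) \<le> sum c ?T" by (intro cost_mono sel_subset)
  also have "\<dots> = sum c (?T - {x}) + c x"
    using xT fin_sub[OF sel_subset] by (subst sum.remove[of ?T x]) auto
  also have "\<dots> \<le> B" using x(1) by (simp add: kept_def addable_def)
  finally show ?thesis using sub by (simp add: feasible_def)
qed

abbreviation gain :: "('a \<Rightarrow> nat) \<Rightarrow> 'a \<Rightarrow> real" where
  "gain \<omega> x \<equiv> f (S \<omega> (Suc (\<omega> x))) - f (S \<omega> (Suc (\<omega> x)) - {x})"

lemma kept_gain: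
  assumes "x \<in> G \<omega>"
  shows "\<tau> * c x \<le> gain \<omega> x" "0 \<le> gain \<omega> x"
proof -
  have "x \<in> S \<omega> (Suc (\<omega> x))" "x \<in> N" using assms by (auto simp: kept_def sel_iff)
  then show *: "\<tau> * c x \<le> gain \<omega> x"
    using assms unfolding kept_def addable_def by (auto simp: insert_absorb)
  have "0 \<le> \<tau> * c x" using tau_nonneg c_pos[OF \<open>x \<in> N\<close>] by simp
  with * show "0 \<le> gain \<omega> x" by linarith
qed

text \<open>Epoch by epoch, \<open>submodular_union_lower\<close> is applied with \<open>T\<close>
  the set selected up to the end of the epoch, which contains all kept elements so far.\<close>

lemma kept_value: "f {} + (\<Sum>x\<in>G \<omega>. gain \<omega> x) \<le> f (G \<omega>)"
proof -
  have "f {} + (\<Sum>x\<in>G \<omega> \<inter> S \<omega> k. gain \<omega> x) \<le> f (G \<omega> \<inter> S \<omega> k)" for k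
  proof (induction k)
    case (Suc k)
    define A where "A = {x \<in> G \<omega>. \<omega> x = k} \<inter> S \<omega> (Suc k)"
    have split: "G \<omega> \<inter> S \<omega> (Suc k) = (G \<omega> \<inter> S \<omega> k) \<union> A"
      unfolding A_def by (auto simp: sel_iff less_Suc_eq)
    have disj: "A \<inter> (G \<omega> \<inter> S \<omega> k) = {}" unfolding A_def by (auto simp: sel_iff)
    have fin: "finite A" "finite (G \<omega> \<inter> S \<omega> k)"
      unfolding A_def by (auto intro!: fin_sub simp: sel_iff)
    have "f (G \<omega> \<inter> S \<omega> k) + (\<Sum>x\<in>A. f (S \<omega> (Suc k)) - f (S \<omega> (Suc k) - {x}))
      \<le> f ((G \<omega> \<inter> S \<omega> k) \<union> A)"
      using disj fin(1) split
      by (intro submodular_union_lower[OF submod _ _ _ sel_subset]) auto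
    moreover have "(\<Sum>x\<in>A. f (S \<omega> (Suc k)) - f (S \<omega> (Suc k) - {x})) = (\<Sum>x\<in>A. gain \<omega> x)"
      by (intro sum.cong) (auto simp: A_def)
    ultimately show ?case
      using Suc fin disj unfolding split by (subst sum.union_disjoint) auto
  qed simp
  from this[of K] show ?thesis using kept_subset[of N c B f \<tau> K \<omega>] by (simp add: Int_absorb2)
qed

lemma kept_density: "\<tau> * sum c (G \<omega>) \<le> f (G \<omega>)"
proof -
  have "\<tau> * sum c (G \<omega>) \<le> (\<Sum>x\<in>G \<omega>. gain \<omega> x)"
    unfolding sum_distrib_left by (intro sum_mono kept_gain)
  then show ?thesis using kept_value[of \<omega>] f_nonneg[of "{}"] by simp
qed

abbreviation "bad \<omega> \<equiv> S \<omega> K - G \<omega>"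

lemma cost_split: "sum c (S \<omega> K) = sum c (G \<omega>) + sum c (bad \<omega>)"
  using kept_subset[of N c B f \<tau> K \<omega>] fin_sub[OF sel_subset]
  by (subst sum.subset_diff[of "G \<omega>"]) auto

end

subsection \<open>Expectations over the random epochs\<close>

text \<open>The value \<open>K\<close> stands for no arrival. In \<open>D_step\<close> an additive
  error is unavoidable at epoch \<open>0\<close>, which has nothing before it;
  \<open>d / card N\<close> sums to at most \<open>d\<close> over all elements.\<close>

locale epoch_process = knapsack_process +
  fixes D :: "nat pmf" and p e d :: real
  assumes D_supp: "set_pmf D \<subseteq> {..K}" and D_K: "pmf D K = 1 - p"
    and p_pos: "0 < p" and e_range: "0 \<le> e" "e < 1" and d_nonneg: "0 \<le> d"
    and D_step: "k < K \<Longrightarrow> pmf D k \<le> e * measure_pmf.prob D {..<k} + d / card N"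
begin

definition P :: "('a \<Rightarrow> nat) pmf" where
  "P = Pi_pmf N K (\<lambda>_. D)"

abbreviation "E \<equiv> measure_pmf.expectation P"
abbreviation "Pr \<equiv> measure_pmf.prob P"

lemma finD: "finite (set_pmf D)"
  using D_supp finite_subset by blast

lemma prob_ge_K: "measure_pmf.prob D {K..} = 1 - p"
proof -
  have "measure_pmf.prob D {K..} = measure_pmf.prob D {K}"
    using D_supp by (intro measure_prob_cong_0) (auto simp: set_pmf_eq intro: ccontr)
  then show ?thesis using D_K by (simp add: measure_pmf_single)
qed

lemma prob_less_K: "measure_pmf.prob D {..<K} = p"
proof -
  have "measure_pmf.prob D {..<K} = 1 - measure_pmf.prob D {K..}"
    by (subst measure_pmf.prob_compl[symmetric]) (auto intro: arg_cong[of _ _ "measure_pmf.prob D"])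
  then show ?thesis by (simp add: prob_ge_K)
qed

lemma p_le_1: "p \<le> 1"
  using prob_less_K measure_pmf.prob_le_1[of D "{..<K}"] by simp

lemma finite_Pi: "finite A \<Longrightarrow> finite (set_pmf (Pi_pmf A K (\<lambda>_. D)))"
  using finD by (auto simp: set_Pi_pmf intro!: finite_PiE_dflt)

lemma int [simp]: "integrable P (F :: _ \<Rightarrow> real)"
  unfolding P_def by (intro integrable_measure_pmf_finite finite_Pi finN)

lemma E_mono:
  fixes F F' :: "('a \<Rightarrow> nat) \<Rightarrow> real"
  assumes "\<And>\<omega>. F \<omega> \<le> F' \<omega>"
  shows "E F \<le> E F'"
  using assms by (intro integral_mono int)

text \<open>Since \<open>K\<close> is the default value, a draw from \<open>Q x\<close> describes
  the process in which \<open>x\<close> never arrives.\<close>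

abbreviation "Q x \<equiv> Pi_pmf (N - {x}) K (\<lambda>_. D)"

lemma Q_supp: "h \<in> set_pmf (Q x) \<Longrightarrow> h x = K"
  using set_Pi_pmf_subset[of "N - {x}" K "\<lambda>_. D"] finN by auto

text \<open>Independence: the other elements draw first, so the process without \<open>x\<close> can
  be held fixed while the epoch of \<open>x\<close> varies.\<close>

lemma resample:
  fixes F :: "('a \<Rightarrow> nat) \<Rightarrow> real"
  assumes "x \<in> N"
  shows "E F = measure_pmf.expectation (Q x)
           (\<lambda>h. measure_pmf.expectation D (\<lambda>y. F (fun_upd h x y)))"
proof -
  have N: "N = insert x (N - {x})" using assms by auto
  have "P = bind_pmf D (\<lambda>y. bind_pmf (Q x) (\<lambda>h. return_pmf (fun_upd h x y)))"
    unfolding P_def using finN by (subst N, subst Pi_pmf_insert') auto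
  also have "\<dots> = bind_pmf (Q x) (\<lambda>h. bind_pmf D (\<lambda>y. return_pmf (fun_upd h x y)))"
    by (rule bind_commute_pmf)
  also have "\<dots> = bind_pmf (Q x) (\<lambda>h. map_pmf (\<lambda>y. fun_upd h x y) D)"
    by (simp add: map_pmf_def)
  finally have *: "P = \<dots>" .
  have fin: "finite (set_pmf (Q x))" using finN by (intro finite_Pi) auto
  show ?thesis
    unfolding * using fin finD
    by (subst pmf_expectation_bind[of "set_pmf (Q x)"], simp, simp, simp,
        subst integral_measure_pmf[of "set_pmf (Q x)"]) auto
qed

lemma prob_resample:
  assumes "x \<in> N"
  shows "Pr {\<omega>. A \<omega>} = measure_pmf.expectation (Q x)
           (\<lambda>h. measure_pmf.prob D {y. A (fun_upd h x y)})"
proof -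
  have "Pr {\<omega>. A \<omega>} = E (indicator {\<omega>. A \<omega>})" by simp
  also have "\<dots> = measure_pmf.expectation (Q x)
      (\<lambda>h. measure_pmf.expectation D (indicator {y. A (fun_upd h x y)}))"
    unfolding resample[OF assms] by (simp only: indicator_def[abs_def] mem_Collect_eq)
  finally show ?thesis by simp
qed

lemma prob_arrival: "x \<in> N \<Longrightarrow> Pr {\<omega>. \<omega> x < K} = p"
  using measure_map_pmf[of "\<lambda>\<omega>. \<omega> x" P "{..<K}"] Pi_pmf_component[OF finN, of x K "\<lambda>_. D"]
  by (simp add: P_def prob_less_K vimage_def)

text \<open>
  Let \<open>x\<close> be taken out of the process. As the other elements arrive, it stops being addable in one
  particular epoch. It is lost if it arrives in exactly that epoch and selected if it arrives
  earlier, and the step condition on \<open>D\<close> compares the two probabilities.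
\<close>
lemma prob_bad:
  assumes x: "x \<in> N"
  shows "Pr {\<omega>. x \<in> bad \<omega>} \<le> e * Pr {\<omega>. x \<in> S \<omega> K} + d / card N"
proof -
  have fin: "finite (set_pmf (Q x))" using finN by (intro finite_Pi) auto
  have intQ: "integrable (Q x) (F :: _ \<Rightarrow> real)" for F
    by (intro integrable_measure_pmf_finite fin)
  have "measure_pmf.prob D {y. x \<in> bad (fun_upd h x y)}
      \<le> e * measure_pmf.prob D {y. x \<in> S (fun_upd h x y) K} + d / card N"
    if h: "h x = K" for h
  proof -
    have notin: "x \<notin> S h k" if "k \<le> K" for k using h that by (auto simp: sel_iff)
    have sel: "x \<in> S (fun_upd h x y) K \<longleftrightarrow> y < K \<and> add (S h y) x" for y
      using h x sel_fun_upd[of y h x y N c B f \<tau>] by (auto simp: sel_iff)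
    \<comment> \<open>If \<open>x\<close> arrives in epoch \<open>y\<close>, the rest of the set
      after that epoch is \<open>S h (Suc y)\<close>, so a bad \<open>x\<close> is addable at the
      start of its epoch and no longer at its end.\<close>
    have bad: "x \<in> bad (fun_upd h x y) \<longleftrightarrow> y < K \<and> add (S h y) x \<and> \<not> add (S h (Suc y)) x" for y
      using h sel[of y] sel_Suc_fun_upd[of y h x N c B f \<tau>] by (auto simp: kept_def)
    show ?thesis
    proof (cases "{y. x \<in> bad (fun_upd h x y)} = {}")
      case True
      then show ?thesis unfolding True using e_range d_nonneg by simp
    next
      case False
      then obtain y where y: "y < K" "add (S h y) x" "\<not> add (S h (Suc y)) x"
        using bad by auto
      have mono: "add (S h k) x" if "add (S h l) x" "k \<le> l" "l \<le> K" for k l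
        using that x notin[of l] by (auto intro: add_sel_antimono)
      have "{y. x \<in> bad (fun_upd h x y)} \<subseteq> {y}"
      proof
        fix z assume "z \<in> {y. x \<in> bad (fun_upd h x y)}"
        then have z: "z < K" "add (S h z) x" "\<not> add (S h (Suc z)) x" using bad by auto
        have "\<not> Suc y \<le> z" "\<not> Suc z \<le> y"
          using y z mono[of z "Suc y"] mono[of y "Suc z"] by auto
        then show "z \<in> {y}" by simp
      qed
      then have "measure_pmf.prob D {y. x \<in> bad (fun_upd h x y)} \<le> measure_pmf.prob D {y}"
        by (intro measure_pmf.finite_measure_mono) auto
      also have "\<dots> \<le> e * measure_pmf.prob D {..<y} + d / card N"
        using D_step[OF y(1)] by (simp add: measure_pmf_single)
      also have "measure_pmf.prob D {..<y} \<le> measure_pmf.prob D {y. x \<in> S (fun_upd h x y) K}"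
        using y sel mono by (intro measure_pmf.finite_measure_mono) auto
      finally show ?thesis using e_range by (auto simp: mult_left_mono)
    qed
  qed
  then have "Pr {\<omega>. x \<in> bad \<omega>} \<le> measure_pmf.expectation (Q x)
      (\<lambda>h. e * measure_pmf.prob D {y. x \<in> S (fun_upd h x y) K} + d / card N)"
    unfolding prob_resample[OF x, of "\<lambda>\<omega>. x \<in> bad \<omega>"]
    by (intro integral_mono_AE intQ) (auto simp: AE_measure_pmf_iff dest: Q_supp)
  also have "\<dots> = e * Pr {\<omega>. x \<in> S \<omega> K} + d / card N"
    unfolding prob_resample[OF x, of "\<lambda>\<omega>. x \<in> S \<omega> K"]
    by (subst Bochner_Integration.integral_add[OF intQ intQ]) simp
  finally show ?thesis .
qed

lemma expected_cost:
  assumes "\<And>\<omega>. R \<omega> \<subseteq> N"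
  shows "E (\<lambda>\<omega>. sum c (R \<omega>)) = (\<Sum>x\<in>N. c x * Pr {\<omega>. x \<in> R \<omega>})"
proof -
  have "sum c (R \<omega>) = (\<Sum>x\<in>N. c x * indicator {\<omega>. x \<in> R \<omega>} \<omega>)" for \<omega>
    using assms[of \<omega>] finN by (simp add: indicator_def sum.If_cases Int_absorb1 Int_def[symmetric] Collect_mem_eq if_distrib cong: if_cong)
  then show ?thesis by simp
qed

text \<open>Weighting \<open>prob_bad\<close> by the costs bounds the bad cost by \<open>e\<close>
  times the selected cost plus \<open>d * B\<close>. The kept part is feasible, so the selected cost
  is at most \<open>B\<close> plus the bad cost, and the inequality is solved for the
  latter.\<close>

lemma expected_bad_cost: "(1 - e) * E (\<lambda>\<omega>. sum c (bad \<omega>)) \<le> (e + d) * B"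
proof -
  have sub: "bad \<omega> \<subseteq> N" "S \<omega> K \<subseteq> N" for \<omega> using sel_subset[of N c B f \<tau> \<omega> K] by auto
  have "E (\<lambda>\<omega>. sum c (bad \<omega>)) \<le> (\<Sum>x\<in>N. c x * (e * Pr {\<omega>. x \<in> S \<omega> K} + d / card N))"
    unfolding expected_cost[OF sub(1)]
    by (intro sum_mono mult_left_mono prob_bad) (auto intro: less_imp_le c_pos)
  also have "\<dots> = e * E (\<lambda>\<omega>. sum c (S \<omega> K)) + (\<Sum>x\<in>N. c x) * (d / card N)"
    unfolding expected_cost[OF sub(2)]
    by (simp add: sum_distrib_left sum_distrib_right sum.distrib sum_divide_distrib distrib_left mult.left_commute)
  also have "(\<Sum>x\<in>N. c x) * (d / card N) \<le> (card N * B) * (d / card N)"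
    using d_nonneg sum_bounded_above[of N c B] c_le by (intro mult_right_mono) auto
  also have "\<dots> \<le> d * B" using d_nonneg B_pos by (cases "card N = 0") auto
  also have "e * E (\<lambda>\<omega>. sum c (S \<omega> K)) \<le> e * E (\<lambda>\<omega>. B + sum c (bad \<omega>))"
    using kept_feasible cost_split e_range
    by (intro mult_left_mono E_mono) (simp_all add: feasible_def)
  also have "\<dots> = e * (B + E (\<lambda>\<omega>. sum c (bad \<omega>)))" by simp
  finally show ?thesis using e_range by (simp add: algebra_simps)
qed

lemma prob_bad_cost:
  assumes "0 < z"
  shows "Pr {\<omega>. z * B \<le> sum c (bad \<omega>)} \<le> (e + d) / ((1 - e) * z)"
proof -
  have "Pr {\<omega> \<in> space P. z * B \<le> sum c (bad \<omega>)} \<le> E (\<lambda>\<omega>. sum c (bad \<omega>)) / (z * B)"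
    using assms B_pos sel_subset[of N c B f \<tau> _ K]
    by (intro integral_Markov_inequality_measure[where A = "{}"] int)
       (auto intro!: AE_I2 cost_nonneg)
  also have "\<dots> \<le> ((e + d) * B / (1 - e)) / (z * B)"
    using expected_bad_cost assms B_pos e_range
    by (intro divide_right_mono) (auto simp: field_simps)
  also have "\<dots> = (e + d) / ((1 - e) * z)" using B_pos by simp
  finally show ?thesis by simp
qed

section \<open>Elements that never arrive, and the expected value of the process\<close>

text \<open>The value that \<open>x\<close> would still add at the end of the process without \<open>x\<close>.\<close>
definition residual :: "'a \<Rightarrow> ('a \<Rightarrow> nat) \<Rightarrow> real" where
  "residual x \<omega> = (let T = S (fun_upd \<omega> x K) K in if add T x then f (insert x T) - f T else 0)"

lemma residual_nonneg: "x \<in> N \<Longrightarrow> 0 \<le> residual x \<omega>"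
  using mult_nonneg_nonneg[OF tau_nonneg less_imp_le[OF c_pos[of x]]]
  by (auto simp: residual_def Let_def addable_def)

text \<open>The residual does not depend on the epoch of \<open>x\<close>, so it is independent of
  whether \<open>x\<close> arrives, and both sides equal \<open>p * (1 - p)\<close> times its
  mean.\<close>

lemma expected_residual:
  assumes x: "x \<in> N"
  shows "p * E (\<lambda>\<omega>. if K \<le> \<omega> x then residual x \<omega> else 0)
       = (1 - p) * E (\<lambda>\<omega>. if \<omega> x < K then residual x \<omega> else 0)"
proof -
  have r: "residual x (fun_upd h x y) = residual x h" for h y by (simp add: residual_def)
  have *: "E (\<lambda>\<omega>. if \<omega> x \<in> A then residual x \<omega> else 0)
      = measure_pmf.prob D A * measure_pmf.expectation (Q x) (residual x)" for A
  proof -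
    have "measure_pmf.expectation D (\<lambda>y. if y \<in> A then residual x h else 0)
        = measure_pmf.prob D A * residual x h" for h
    proof -
      have "(\<lambda>y. if y \<in> A then residual x h else 0) = (\<lambda>y. indicator A y * residual x h)" by auto
      then show ?thesis by simp
    qed
    then show ?thesis unfolding resample[OF x] r fun_upd_same by simp
  qed
  show ?thesis using *[of "{K..}"] *[of "{..<K}"] by (simp add: prob_ge_K prob_less_K)
qed

text \<open>If \<open>x\<close> arrives and would be addable even at the end of the process without
  it, then it is addable before and after its own epoch. Hence it is kept, with a gain no smaller
  than its residual.\<close>

lemma residual_le_value:
  assumes "V \<subseteq> N"
  shows "(\<Sum>x\<in>V. if \<omega> x < K then residual x \<omega> else 0) \<le> f (G \<omega>)"
proof -
  have "(if \<omega> x < K then residual x \<omega> else 0) \<le> (if x \<in> G \<omega> then gain \<omega> x else 0)"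
    if x: "x \<in> V" for x
  proof (cases "\<omega> x < K \<and> add (S (fun_upd \<omega> x K) K) x")
    case True
    define h where "h = fun_upd \<omega> x K"
    have h: "h x = K" "fun_upd h x (\<omega> x) = \<omega>" by (auto simp: h_def)
    have xN: "x \<in> N" using x assms by auto
    have notin: "x \<notin> S h k" if "k \<le> K" for k using h that by (auto simp: sel_iff)
    have T: "add (S h K) x" using True by (simp add: h_def)
    have mono: "add (S h k) x" if "k \<le> K" for k
      using that T xN notin[of K] by (auto intro: add_sel_antimono)
    have S1: "S \<omega> (\<omega> x) = S h (\<omega> x)"
      using True h sel_fun_upd[of "\<omega> x" h x "\<omega> x" N c B f \<tau>] by auto
    have S2: "S \<omega> (Suc (\<omega> x)) - {x} = S h (Suc (\<omega> x))"
      using True h sel_Suc_fun_upd[of "\<omega> x" h x N c B f \<tau>] by auto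
    have inS: "x \<in> S \<omega> K" "x \<in> S \<omega> (Suc (\<omega> x))"
      using True xN S1 mono[of "\<omega> x"] by (auto simp: sel_iff)
    have "x \<in> G \<omega>" using inS S2 mono[of "Suc (\<omega> x)"] True by (simp add: kept_def)
    moreover have "S \<omega> (Suc (\<omega> x)) = insert x (S h (Suc (\<omega> x)))" using S2 inS by auto
    \<comment> \<open>The set only grows from the end of the epoch of \<open>x\<close> to the end of
      the process.\<close>
    moreover have "f (insert x (S h K)) - f (S h K)
        \<le> f (insert x (S h (Suc (\<omega> x)))) - f (S h (Suc (\<omega> x)))"
      using True xN notin by (intro submodular_onD[OF submod] sel_mono sel_subset) auto
    ultimately show ?thesis using True T S2 by (simp add: residual_def Let_def h_def[symmetric])
  next
    case False
    then have "(if \<omega> x < K then residual x \<omega> else 0) = 0" by (auto simp: residual_def)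
    then show ?thesis using kept_gain(2)[of x \<omega>] by simp
  qed
  then have "(\<Sum>x\<in>V. if \<omega> x < K then residual x \<omega> else 0)
      \<le> (\<Sum>x\<in>V. if x \<in> G \<omega> then gain \<omega> x else 0)"
    by (intro sum_mono)
  also have "\<dots> = (\<Sum>x\<in>V \<inter> G \<omega>. gain \<omega> x)"
    using fin_sub[OF assms] by (simp add: sum.inter_restrict)
  also have "\<dots> \<le> (\<Sum>x\<in>G \<omega>. gain \<omega> x)"
    using kept_subset[of N c B f \<tau> K \<omega>] sel_subset[of N c B f \<tau> \<omega> K]
    by (intro sum_mono2 fin_sub kept_gain(2)) auto
  also have "\<dots> \<le> f (G \<omega>)" using kept_value[of \<omega>] f_nonneg[of "{}"] by simp
  finally show ?thesis .
qed

text \<open>Each element of \<open>V\<close> outside the selection is \<open>v\<close>, or failed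
  the density test and adds at most \<open>\<tau> * c x\<close>, or never arrived and adds its
  residual.\<close>

lemma union_value:
  assumes V: "V \<subseteq> N" "v \<in> V" "sum c (V - {v}) \<le> \<Gamma>"
    and fits: "\<And>x. x \<in> V - {v} \<Longrightarrow> c x + \<Gamma> \<le> B"
    and small: "sum c (S \<omega> K) \<le> \<Gamma>"
  shows "f (V \<union> S \<omega> K) \<le> f (S \<omega> K) + f {v} + \<tau> * \<Gamma>
           + (\<Sum>x\<in>V. if K \<le> \<omega> x then residual x \<omega> else 0)"
proof -
  let ?T = "S \<omega> K"
  let ?r = "\<lambda>x. if K \<le> \<omega> x then residual x \<omega> else 0"
  let ?w = "\<lambda>x. if x = v then f {v} else \<tau> * c x"
  have finV: "finite V" using fin_sub[OF V(1)] .
  have r: "0 \<le> ?r x" if "x \<in> V" for x using that V residual_nonneg[of x] by auto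
  have w: "0 \<le> ?w x" if "x \<in> V" for x
    using that V f_nonneg[of "{v}"] tau_nonneg c_pos[of x] by auto
  have "f (insert x ?T) - f ?T \<le> ?w x + ?r x" if x: "x \<in> V - ?T" for x
  proof (cases "x = v")
    case True
    have "f (insert x ?T) - f ?T \<le> f (insert x {}) - f {}"
      using x V by (intro submodular_onD[OF submod _ sel_subset]) auto
    then show ?thesis using True r[of x] x f_nonneg[of "{}"] by auto
  next
    case False
    show ?thesis
    proof (cases "add ?T x")
      case True
      \<comment> \<open>An arriving element that is addable at the end was addable in its own epoch
        and would have been selected.\<close>
      have "\<not> \<omega> x < K"
      proof
        assume *: "\<omega> x < K"
        then have "add (S \<omega> (\<omega> x)) x"
          using x V True by (intro add_sel_antimono[of "\<omega> x" K]) auto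
        then show False using x V * by (auto simp: sel_iff)
      qed
      moreover from this have "S (fun_upd \<omega> x K) K = ?T" by (intro sel_fun_upd) auto
      ultimately have "?r x = f (insert x ?T) - f ?T"
        using True by (simp add: residual_def Let_def)
      then show ?thesis using w[of x] x by auto
    next
      case F: False
      \<comment> \<open>The budget test succeeds, so it was the density test that failed.\<close>
      have "sum c ?T + c x \<le> B" using fits[of x] x False small by auto
      then have "f (insert x ?T) - f ?T \<le> \<tau> * c x" using F by (auto simp: addable_def)
      then show ?thesis using False r[of x] x by auto
    qed
  qed
  then have "(\<Sum>x\<in>V - ?T. f (insert x ?T) - f ?T) \<le> (\<Sum>x\<in>V - ?T. ?w x + ?r x)"
    by (intro sum_mono) auto
  also have "\<dots> \<le> (\<Sum>x\<in>V. ?w x + ?r x)"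
    using finV w r by (intro sum_mono2) (auto intro!: add_nonneg_nonneg)
  also have "\<dots> = (\<Sum>x\<in>V. ?w x) + (\<Sum>x\<in>V. ?r x)" by (rule sum.distrib)
  also have "(\<Sum>x\<in>V. ?w x) = f {v} + \<tau> * sum c (V - {v})"
    using finV V(2) by (subst sum.remove[of V v]) (auto simp: sum_distrib_left)
  also have "\<dots> \<le> f {v} + \<tau> * \<Gamma>" using V tau_nonneg by (auto intro: mult_left_mono)
  finally have "(\<Sum>x\<in>V - ?T. f (insert x ?T) - f ?T) \<le> f {v} + \<tau> * \<Gamma> + (\<Sum>x\<in>V. ?r x)"
    by simp
  moreover have "f (?T \<union> (V - ?T)) - f ?T \<le> (\<Sum>x\<in>V - ?T. f (insert x ?T) - f ?T)"
    using V finV by (intro submodular_union_upper[OF submod] sel_subset) auto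
  moreover have "?T \<union> (V - ?T) = V \<union> ?T" by auto
  ultimately show ?thesis by simp
qed

text \<open>The mean of \<open>f (V \<union> R \<omega>)\<close> is bounded below by the sampling
  lemma and above by \<open>union_value\<close>. The residuals of absent elements are traded for
  those of arrived ones at the rate \<open>(1 - p) / p\<close>, and the latter are covered by the
  kept value.\<close>

lemma small_cost_value:
  assumes V: "V \<subseteq> N" "v \<in> V" "sum c (V - {v}) \<le> \<Gamma>"
    and fits: "\<And>x. x \<in> V - {v} \<Longrightarrow> c x + \<Gamma> \<le> B"
  shows "(Pr {\<omega>. sum c (S \<omega> K) \<le> \<Gamma>} - p) * f V
    \<le> E (\<lambda>\<omega>. if sum c (S \<omega> K) \<le> \<Gamma> then f (S \<omega> K) else 0) + f {v} + \<tau> * \<Gamma>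
        + (1 - p) / p * E (\<lambda>\<omega>. f (G \<omega>))"
proof -
  let ?small = "\<lambda>\<omega>. sum c (S \<omega> K) \<le> \<Gamma>"
  let ?L = "\<lambda>\<omega>. \<Sum>x\<in>V. if K \<le> \<omega> x then residual x \<omega> else 0"
  let ?L' = "\<lambda>\<omega>. \<Sum>x\<in>V. if \<omega> x < K then residual x \<omega> else 0"
  define R where "R = (\<lambda>\<omega>. if ?small \<omega> then S \<omega> K else {})"
  have L_nonneg: "0 \<le> ?L \<omega>" for \<omega> using V residual_nonneg by (intro sum_nonneg) auto
  have "0 \<le> sum c (V - {v})" using V by (intro cost_nonneg) auto
  then have pos: "0 \<le> f {v} + \<tau> * \<Gamma>"
    using V f_nonneg[of "{v}"] tau_nonneg by auto
  have RN: "R \<omega> \<subseteq> N" for \<omega> unfolding R_def by (auto simp: sel_iff)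
  have "(1 - p) * f (V \<union> {}) \<le> E (\<lambda>\<omega>. f (V \<union> R \<omega>))"
  proof (rule expectation_random_subset[where N = N])
    show "submodular_on N (\<lambda>A. f (V \<union> A))" by (rule submodular_on_union_left[OF submod V(1)])
    show "finite (set_pmf P)" unfolding P_def by (rule finite_Pi[OF finN])
    show "Pr {\<omega>. x \<in> R \<omega>} \<le> p" if "x \<in> N" for x
      unfolding prob_arrival[OF that, symmetric]
      by (intro measure_pmf.finite_measure_mono) (auto simp: R_def sel_iff split: if_splits)
  qed (use V f_nonneg finN p_pos RN in auto)
  also have "\<dots> \<le> E (\<lambda>\<omega>. (if ?small \<omega> then f (S \<omega> K) else 0) + (f {v} + \<tau> * \<Gamma>) + ?L \<omega>
                      + (1 - indicator {\<omega>. ?small \<omega>} \<omega>) * f V)"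
  proof (rule E_mono)
    fix \<omega>
    show "f (V \<union> R \<omega>) \<le> (if ?small \<omega> then f (S \<omega> K) else 0) + (f {v} + \<tau> * \<Gamma>) + ?L \<omega>
                      + (1 - indicator {\<omega>. ?small \<omega>} \<omega>) * f V"
      using union_value[OF V fits, of \<omega>] L_nonneg[of \<omega>] pos by (auto simp: R_def)
  qed
  also have "\<dots> = E (\<lambda>\<omega>. if ?small \<omega> then f (S \<omega> K) else 0) + (f {v} + \<tau> * \<Gamma>) + E ?L
                      + (1 - Pr {\<omega>. ?small \<omega>}) * f V"
    by (simp del: Bochner_Integration.integral_sum)
  finally have 1: "(Pr {\<omega>. ?small \<omega>} - p) * f V
    \<le> E (\<lambda>\<omega>. if ?small \<omega> then f (S \<omega> K) else 0) + (f {v} + \<tau> * \<Gamma>) + E ?L"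
    by (simp add: algebra_simps)
  have "p * E ?L = (\<Sum>x\<in>V. p * E (\<lambda>\<omega>. if K \<le> \<omega> x then residual x \<omega> else 0))"
    by (simp add: sum_distrib_left)
  also have "\<dots> = (\<Sum>x\<in>V. (1 - p) * E (\<lambda>\<omega>. if \<omega> x < K then residual x \<omega> else 0))"
    using V by (intro sum.cong expected_residual) auto
  also have "\<dots> = (1 - p) * E ?L'" by (simp add: sum_distrib_left)
  also have "\<dots> \<le> (1 - p) * E (\<lambda>\<omega>. f (G \<omega>))"
    using p_le_1 by (intro mult_left_mono E_mono residual_le_value V) auto
  finally have "E ?L \<le> (1 - p) / p * E (\<lambda>\<omega>. f (G \<omega>))"
    using p_pos by (simp add: field_simps)
  with 1 show ?thesis by simp
qed

lemma large_cost_value: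
  assumes "\<Gamma> < sum c (S \<omega> K)" "sum c (bad \<omega>) \<le> z"
  shows "\<tau> * (\<Gamma> - z) \<le> f (G \<omega>)"
proof -
  have "\<tau> * (\<Gamma> - z) \<le> \<tau> * sum c (G \<omega>)"
    using assms cost_split[of \<omega>] tau_nonneg by (intro mult_left_mono) auto
  then show ?thesis using kept_density[of \<omega>] by linarith
qed

text \<open>The two cases give an expectation of at least \<open>27/250 * f V\<close> and
  \<open>8/75 * f V\<close>; both exceed \<open>f V / 9.465\<close>.\<close>

lemma repeated_value:
  fixes Z :: "(nat \<Rightarrow> 'a \<Rightarrow> nat) \<Rightarrow> real"
  assumes par: "p = 1/3" "e = 1/1000" "d = 1/1000"
    and V: "V \<subseteq> N" "v \<in> V" "sum c (V - {v}) \<le> \<Gamma>"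
    and fits: "\<And>x. x \<in> V - {v} \<Longrightarrow> c x + \<Gamma> \<le> B"
    and \<Gamma>: "B / 2 \<le> \<Gamma>" "\<Gamma> \<le> B"
    and \<tau>: "4/25 * f V \<le> \<tau> * \<Gamma>" "\<tau> * \<Gamma> \<le> 1/5 * f V"
    and Z_v: "\<And>\<omega>. f {v} \<le> Z \<omega>"
    and Z_G: "\<And>\<omega> i. i < 128 \<Longrightarrow> f (G (\<omega> i)) \<le> Z \<omega>"
    and Z_S: "\<And>\<omega> i. i < 128 \<Longrightarrow> sum c (S (\<omega> i) K) \<le> B \<Longrightarrow> f (S (\<omega> i) K) \<le> Z \<omega>"
  shows "f V \<le> 9.465 * measure_pmf.expectation (Pi_pmf {..<128} dflt (\<lambda>_. P)) Z"
proof -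
  define \<Omega> where "\<Omega> = Pi_pmf {..<128::nat} dflt (\<lambda>_. P)"
  have finP: "finite (set_pmf P)" unfolding P_def by (rule finite_Pi[OF finN])
  then have "finite (set_pmf \<Omega>)" by (auto simp: \<Omega>_def set_Pi_pmf intro!: finite_PiE_dflt)
  then have int\<Omega> [simp]: "integrable \<Omega> (F :: _ \<Rightarrow> real)" for F
    by (rule integrable_measure_pmf_finite)
  have Z_nonneg: "0 \<le> Z \<omega>" for \<omega> using Z_v[of \<omega>] V f_nonneg[of "{v}"] by auto
  have fV: "0 \<le> f V" using f_nonneg V by auto
  define W where "W = {\<omega>. \<Gamma> < sum c (S \<omega> K) \<and> sum c (bad \<omega>) < 1/8 * B}"
  show ?thesis
  proof (cases "Pr W \<ge> 1/50")
    case True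
    define U where "U = Pi {..<128::nat} (\<lambda>_. - W)"
    have "measure_pmf.prob \<Omega> U = (1 - Pr W) ^ 128"
      unfolding \<Omega>_def U_def by (subst measure_Pi_pmf_Pi) (auto simp: measure_pmf.prob_compl[symmetric] Compl_eq_Diff_UNIV)
    \<comment> \<open>The number of copies is chosen so that all of them miss \<open>W\<close> with
      probability at most \<open>1/10\<close>.\<close>
    also have "\<dots> \<le> (49/50) ^ 128" using True by (intro power_mono) auto
    also have "\<dots> \<le> (1/10 :: real)" by (simp add: power_divide)
    finally have U: "measure_pmf.prob \<Omega> U \<le> 1/10" .
    have Z: "(3/25 * f V) * (1 - indicator U \<omega>) \<le> Z \<omega>" for \<omega>
    proof (cases "\<omega> \<in> U")
      case False
      then obtain i where i: "i < 128" "\<omega> i \<in> W" unfolding U_def by auto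
      have "3/25 * f V \<le> 3/4 * (\<tau> * \<Gamma>)" using \<tau> by linarith
      also have "\<dots> = \<tau> * (3/4 * \<Gamma>)" by simp
      \<comment> \<open>\<open>B \<le> 2 * \<Gamma>\<close> makes \<open>B / 8\<close> at most a
        quarter of \<open>\<Gamma>\<close>.\<close>
      also have "\<dots> \<le> \<tau> * (\<Gamma> - 1/8 * B)" using tau_nonneg \<Gamma> by (intro mult_left_mono) auto
      also have "\<dots> \<le> f (G (\<omega> i))" using i(2) unfolding W_def by (intro large_cost_value) auto
      also have "\<dots> \<le> Z \<omega>" using Z_G i by auto
      finally show ?thesis using False by simp
    qed (simp add: Z_nonneg)
    have "3/25 * f V * (9/10) \<le> 3/25 * f V * (1 - measure_pmf.prob \<Omega> U)"
      using U fV by (intro mult_left_mono) auto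
    also have "\<dots> = measure_pmf.expectation \<Omega> (\<lambda>\<omega>. (3/25 * f V) * (1 - indicator U \<omega>))" by simp
    also have "\<dots> \<le> measure_pmf.expectation \<Omega> Z" using Z by (intro integral_mono int\<Omega>) auto
    finally show ?thesis using fV by (simp add: \<Omega>_def[symmetric])
  next
    case False
    let ?VZ = "measure_pmf.expectation \<Omega> Z"
    have proj: "E F \<le> ?VZ" if "\<And>\<omega>. F (\<omega> 0) \<le> Z \<omega>" for F :: "('a \<Rightarrow> nat) \<Rightarrow> real"
    proof -
      have "map_pmf (\<lambda>\<omega>. \<omega> 0) \<Omega> = P" unfolding \<Omega>_def by (subst Pi_pmf_component) auto
      then have "E F = measure_pmf.expectation \<Omega> (\<lambda>\<omega>. F (\<omega> 0))" by (metis integral_map_pmf)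
      also have "\<dots> \<le> ?VZ" using that by (intro integral_mono int\<Omega>) auto
      finally show ?thesis .
    qed
    have 1: "E (\<lambda>\<omega>. if sum c (S \<omega> K) \<le> \<Gamma> then f (S \<omega> K) else 0) \<le> ?VZ"
      using Z_S[of 0] Z_nonneg \<Gamma> by (intro proj) auto
    have 2: "E (\<lambda>\<omega>. f (G \<omega>)) \<le> ?VZ" using Z_G[of 0] by (intro proj) auto
    have 3: "f {v} \<le> ?VZ" using proj[of "\<lambda>_. f {v}"] Z_v by simp
    have "1 - Pr {\<omega>. sum c (S \<omega> K) \<le> \<Gamma>} = Pr (- {\<omega>. sum c (S \<omega> K) \<le> \<Gamma>})"
      by (simp add: measure_pmf.prob_compl[symmetric] Compl_eq_Diff_UNIV)
    also have "\<dots> \<le> Pr (W \<union> {\<omega>. 1/8 * B \<le> sum c (bad \<omega>)})"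
      unfolding W_def by (intro measure_pmf.finite_measure_mono) auto
    also have "\<dots> \<le> Pr W + Pr {\<omega>. 1/8 * B \<le> sum c (bad \<omega>)}"
      by (intro measure_Un_le) auto
    \<comment> \<open>\<open>prob_bad_cost\<close> gives \<open>(2/1000) / (999/1000 * 1/8)\<close>,
      about \<open>0.016\<close>.\<close>
    also have "Pr {\<omega>. 1/8 * B \<le> sum c (bad \<omega>)} \<le> 1/50"
      using prob_bad_cost[of "1/8"] by (simp add: par)
    also have "Pr W \<le> 1/50" using False by simp
    finally have "24/25 \<le> Pr {\<omega>. sum c (S \<omega> K) \<le> \<Gamma>}" by simp
    then have "(24/25 - 1/3) * f V \<le> (Pr {\<omega>. sum c (S \<omega> K) \<le> \<Gamma>} - p) * f V"
      using fV par by (intro mult_right_mono) auto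
    \<comment> \<open>One \<open>?VZ\<close> pays for the selected set, one for
      \<open>f {v}\<close>, and two for the kept set.\<close>
    also have "\<dots> \<le> ?VZ + ?VZ + 1/5 * f V + 2 * ?VZ"
    proof -
      have "(1 - p) / p = 2" unfolding par by simp
      from small_cost_value[OF V fits, unfolded this] show ?thesis using 1 2 3 \<tau> by linarith
    qed
    finally show ?thesis using fV by (simp add: \<Omega>_def[symmetric])
  qed
qed

end

subsection \<open>The distribution of the epochs\<close>

definition mix_pmf :: "real \<Rightarrow> nat pmf \<Rightarrow> nat \<Rightarrow> nat pmf" where
  "mix_pmf q D k = bind_pmf (bernoulli_pmf q) (\<lambda>b. if b then D else return_pmf k)"

lemma prob_mix_pmf:
  assumes "0 \<le> q" "q \<le> 1"
  shows "measure_pmf.prob (mix_pmf q D k) A = q * measure_pmf.prob D A + (1 - q) * indicator A k"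
proof -
  have *: "measure_pmf.prob p A = pmf (map_pmf (\<lambda>x. x \<in> A) p) True" for p :: "nat pmf"
    by (simp add: pmf_map vimage_def)
  show ?thesis
    unfolding * mix_pmf_def map_bind_pmf pmf_bind using assms
    by (simp add: indicator_def)
qed

lemma set_mix_pmf: "set_pmf (mix_pmf q D k) \<subseteq> insert k (set_pmf D)"
  by (auto simp: mix_pmf_def split: if_splits)

text \<open>For \<open>k \<le> m\<close> the mass of \<open>{..k}\<close> is
  \<open>(1 / (1 + e)) ^ (m - k)\<close>, so from \<open>k = 1\<close> on each epoch has exactly
  \<open>e\<close> times the mass of all earlier ones.\<close>

primrec epoch_pmf :: "real \<Rightarrow> nat \<Rightarrow> nat pmf" where
  "epoch_pmf e 0 = return_pmf 0"
| "epoch_pmf e (Suc m) = mix_pmf (1 / (1 + e)) (epoch_pmf e m) (Suc m)"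

lemma set_epoch_pmf: "set_pmf (epoch_pmf e m) \<subseteq> {..m}"
proof (induction m)
  case (Suc m)
  then show ?case using set_mix_pmf[of "1 / (1 + e)" "epoch_pmf e m" "Suc m"] by auto
qed simp

text \<open>The power is the mass of epoch \<open>0\<close>. In the induction, mixing scales the old
  masses by \<open>r\<close>, and the new epoch gets \<open>1 - r = e * r\<close>.\<close>

lemma epoch_pmf_step:
  assumes "0 \<le> e" "k \<le> m"
  shows "pmf (epoch_pmf e m) k \<le> e * measure_pmf.prob (epoch_pmf e m) {..<k} + (1 / (1 + e)) ^ m"
  using assms(2)
proof (induction m)
  case 0
  then show ?case by simp
next
  case (Suc m)
  define r where "r = 1 / (1 + e)"
  have r: "0 \<le> r" "r \<le> 1" "e * r = 1 - r" using assms(1) by (auto simp: r_def field_simps)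
  note mix = prob_mix_pmf[OF r(1,2)]
  show ?case
  proof (cases "k = Suc m")
    case True
    have "measure_pmf.prob (epoch_pmf e m) {k} = 0"
      using set_epoch_pmf[of e m] True by (auto simp: measure_pmf_single set_pmf_eq)
    moreover have "measure_pmf.prob (epoch_pmf e m) {..<k} = 1"
      using set_epoch_pmf[of e m] True by (intro measure_pmf.prob_eq_1[THEN iffD2]) (auto simp: AE_measure_pmf_iff)
    ultimately show ?thesis
      using r unfolding epoch_pmf.simps r_def[symmetric] measure_pmf_single[symmetric] mix
      by (simp add: True)
  next
    case False
    then have "k \<le> m" using Suc by simp
    then have "r * pmf (epoch_pmf e m) k
        \<le> r * (e * measure_pmf.prob (epoch_pmf e m) {..<k} + r ^ m)"
      using Suc.IH r by (intro mult_left_mono) (auto simp: r_def)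
    then show ?thesis
      using False Suc.prems unfolding epoch_pmf.simps r_def[symmetric]
      by (subst measure_pmf_single[symmetric], unfold mix)
         (simp add: measure_pmf_single algebra_simps)
  qed
qed

subsection \<open>Simulating a round-based query plan\<close>

text \<open>
  The plan and the output are functions of the objective. The oracle algorithm evaluates them on
  a function \<open>g\<close> that carries the answers received so far.
\<close>
primrec exec ::
  "(('a set \<Rightarrow> real) \<Rightarrow> nat \<Rightarrow> 'a set list) \<Rightarrow> (('a set \<Rightarrow> real) \<Rightarrow> 'a set) \<Rightarrow>
     nat \<Rightarrow> nat \<Rightarrow> ('a set \<Rightarrow> real) \<Rightarrow> 'a oracle_alg" where
  "exec plan out 0 r g = Output (out g)"
| "exec plan out (Suc m) r g = Round (plan g r) (\<lambda>ans. exec plan out m (Suc r)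
     (\<lambda>T. case map_of (zip (plan g r) ans) T of Some v \<Rightarrow> v | None \<Rightarrow> g T))"

definition agree ::
  "(('a set \<Rightarrow> real) \<Rightarrow> nat \<Rightarrow> 'a set list) \<Rightarrow> ('a set \<Rightarrow> real) \<Rightarrow> ('a set \<Rightarrow> real) \<Rightarrow> nat \<Rightarrow> bool" where
  "agree plan f g r \<longleftrightarrow> (\<forall>s<r. \<forall>T\<in>set (plan f s). f T = g T)"

text \<open>If plan and output depend only on answers already received, evaluating them on
  \<open>g\<close> is as good as on \<open>f\<close>, and each round extends the agreement by its
  own queries.\<close>

lemma run_exec:
  assumes plan: "\<And>g r. r < t \<Longrightarrow> agree plan f g r \<Longrightarrow> plan g r = plan f r"
    and out: "\<And>g. agree plan f g t \<Longrightarrow> out g = out f"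
    and "agree plan f g r" "r + m = t"
  shows "run f (exec plan out m r g) = return_pmf (out f, map (plan f) [r..<t])"
  using assms(3,4)
proof (induction m arbitrary: r g)
  case 0
  then show ?case using out by simp
next
  case (Suc m)
  have q: "plan g r = plan f r" using plan Suc.prems by auto
  let ?g = "\<lambda>T. case map_of (zip (plan f r) (map f (plan f r))) T of Some v \<Rightarrow> v | None \<Rightarrow> g T"
  have "agree plan f ?g (Suc r)"
    using Suc.prems by (auto simp: agree_def map_of_zip_map less_Suc_eq)
  moreover have "[r..<t] = r # [Suc r..<t]" using Suc.prems by (simp add: upt_conv_Cons)
  ultimately show ?case using Suc.IH[of ?g "Suc r"] Suc.prems q by simp
qed

section \<open>Thresholds and the query plan\<close>

definition top_value :: "'a set \<Rightarrow> ('a set \<Rightarrow> real) \<Rightarrow> real" where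
  "top_value N f = Max (insert (f {}) ((\<lambda>x. f {x}) ` N))"

text \<open>The ratio \<open>5/4\<close> is that of \<open>1/5\<close> to \<open>4/25\<close>, so
  the grid cannot jump over this window; the factor \<open>1/10\<close> starts it below the
  window.\<close>

definition threshold :: "'a set \<Rightarrow> real \<Rightarrow> ('a set \<Rightarrow> real) \<Rightarrow> nat \<Rightarrow> real" where
  "threshold N B f j = top_value N f / (10 * B) * (5/4) ^ j"

locale schedule =
  fixes N :: "'a set" and c :: "'a \<Rightarrow> real" and B :: real and xs :: "'a list"
    and M J K :: nat and \<omega> :: "nat \<Rightarrow> 'a \<Rightarrow> nat"
  assumes xs: "set xs = N"
begin

abbreviation "sel' f \<equiv> \<lambda>(i, j). sel N c B f (threshold N B f j) (\<omega> i)"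
abbreviation "kept' f \<equiv> \<lambda>(i, j). kept N c B f (threshold N B f j) K (\<omega> i)"
abbreviation "idx \<equiv> List.product [0..<M] [0..<J]"

text \<open>Round \<open>0\<close> fixes the thresholds, rounds \<open>1\<close> to \<open>K\<close>
  simulate one epoch each for all copies and guesses in parallel, round \<open>K + 1\<close>
  determines the kept elements, and round \<open>K + 2\<close> evaluates the results.\<close>

definition plan :: "('a set \<Rightarrow> real) \<Rightarrow> nat \<Rightarrow> 'a set list" where
  "plan f r =
     (if r = 0 then {} # map (\<lambda>x. {x}) xs
      else if r \<le> K then
        concat (map (\<lambda>a. sel' f a (r - 1) # map (\<lambda>x. insert x (sel' f a (r - 1))) xs) idx)
      else if r = Suc K then
        concat (map (\<lambda>a. concat (map (\<lambda>x. let T = sel' f a (Suc (\<omega> (fst a) x)) - {x} in [T, insert x T])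
          (filter (\<lambda>x. \<omega> (fst a) x < K) xs))) idx)
      else concat (map (\<lambda>a. [sel' f a K, kept' f a]) idx))"

text \<open>A selected set may exceed the budget; this is checked from the costs alone, without
  queries.\<close>

definition candidates :: "('a set \<Rightarrow> real) \<Rightarrow> 'a set set" where
  "candidates f = {T. feasible N c B T} \<inter>
     set ({} # map (\<lambda>x. {x}) xs @ concat (map (\<lambda>a. [sel' f a K, kept' f a]) idx))"

definition out :: "('a set \<Rightarrow> real) \<Rightarrow> 'a set" where
  "out f = (SOME T. T \<in> candidates f \<and> (\<forall>T' \<in> candidates f. f T' \<le> f T))"

lemma agreeD: "agree plan f g r \<Longrightarrow> s < r \<Longrightarrow> T \<in> set (plan f s) \<Longrightarrow> f T = g T"
  by (auto simp: agree_def)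

lemma threshold_local:
  assumes "agree plan f g r" "0 < r"
  shows "threshold N B f j = threshold N B g j"
proof -
  have eq: "f T = g T" if "T \<in> insert {} ((\<lambda>x. {x}) ` N)" for T
    using agreeD[OF assms, of T] that xs by (auto simp: plan_def)
  then have "(\<lambda>x. f {x}) ` N = (\<lambda>x. g {x}) ` N" by (intro image_cong) auto
  then show ?thesis using eq[of "{}"] by (simp add: threshold_def top_value_def)
qed

lemma addable_cong:
  "f (insert x T) = g (insert x T) \<Longrightarrow> f T = g T \<Longrightarrow> addable c B f \<tau> T x = addable c B g \<tau> T x"
  by (simp add: addable_def)

text \<open>The set after \<open>k + 1\<close> epochs depends only on the thresholds and on values
  around the set after \<open>k\<close> epochs, which round \<open>k + 1\<close> has
  queried.\<close>

lemma sel_local: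
  assumes "agree plan f g r" "a \<in> set idx" "k < r" "k \<le> K"
  shows "sel' f a k = sel' g a k"
  using assms(3,4)
proof (induction k)
  case 0
  then show ?case by (simp split: prod.splits)
next
  case (Suc k)
  obtain i j where a: "a = (i, j)" by (cases a)
  have IH: "sel' f a k = sel' g a k" using Suc by simp
  have th: "threshold N B f j = threshold N B g j" using threshold_local[OF assms(1)] Suc by simp
  have q: "f T = g T" if "T \<in> insert (sel' f a k) ((\<lambda>x. insert x (sel' f a k)) ` N)" for T
    using that Suc.prems assms(2) xs
    by (intro agreeD[OF assms(1), of "Suc k"]) (auto simp: plan_def)
  have "addable c B f (threshold N B f j) (sel' f a k) x
      = addable c B g (threshold N B f j) (sel' f a k) x" if "x \<in> N" for x
    using that by (intro addable_cong q) auto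
  then show ?case using IH th unfolding a by (auto simp: sel.simps(2))
qed

lemma kept_local:
  assumes "agree plan f g r" "a \<in> set idx" "Suc K < r"
  shows "kept' f a = kept' g a"
proof -
  obtain i j where a: "a = (i, j)" by (cases a)
  have S: "sel' f a k = sel' g a k" if "k \<le> K" for k
    using sel_local[OF assms(1,2)] assms(3) that by auto
  have th: "threshold N B f j = threshold N B g j" using threshold_local[OF assms(1)] assms by simp
  have "addable c B f (threshold N B f j) (sel' f a (Suc (\<omega> i x)) - {x}) x
      = addable c B g (threshold N B g j) (sel' g a (Suc (\<omega> i x)) - {x}) x"
    if x: "x \<in> N" "\<omega> i x < K" for x
  proof -
    let ?T = "sel' f a (Suc (\<omega> i x)) - {x}"
    have "f T = g T" if "T \<in> {?T, insert x ?T}" for T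
    proof (rule agreeD[OF assms(1,3)])
      have "T \<in> (\<Union>a\<in>set idx. \<Union>x\<in>{x \<in> N. \<omega> (fst a) x < K}.
          {sel' f a (Suc (\<omega> (fst a) x)) - {x}, insert x (sel' f a (Suc (\<omega> (fst a) x)) - {x})})"
        using that x unfolding a by (intro UN_I[OF assms(2)] UN_I[of x]) (auto simp: a)
      also have "\<dots> = set (plan f (Suc K))" by (auto simp: plan_def Let_def xs)
      finally show "T \<in> set (plan f (Suc K))" .
    qed
    then have "addable c B f (threshold N B f j) ?T x = addable c B g (threshold N B f j) ?T x"
      by (intro addable_cong) blast+
    then show ?thesis using S[of "Suc (\<omega> i x)"] x th by simp
  qed
  then show ?thesis using S[of K] unfolding a kept_def prod.case
    by (intro Collect_cong conj_cong) (auto simp: sel_iff)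
qed

lemma plan_local:
  assumes "agree plan f g r"
  shows "plan g r = plan f r"
proof -
  consider "r = 0" | "0 < r" "r \<le> K" | "r = Suc K" | "Suc K < r" by linarith
  then show ?thesis
  proof cases
    case 2
    then have "sel' f a (r - 1) = sel' g a (r - 1)" if "a \<in> set idx" for a
      using sel_local[OF assms that, of "r - 1"] by auto
    then show ?thesis using 2 unfolding plan_def by (auto intro!: arg_cong[of _ _ concat] map_cong)
  next
    case 3
    then have "sel' f a k = sel' g a k" if "a \<in> set idx" "k \<le> K" for a k
      using sel_local[OF assms that(1), of k] that by auto
    then show ?thesis
      using 3 unfolding plan_def Let_def by (auto intro!: arg_cong[of _ _ concat] map_cong)
  next
    case 4
    then have "sel' f a K = sel' g a K" "kept' f a = kept' g a" if "a \<in> set idx" for a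
      using sel_local[OF assms that, of K] kept_local[OF assms that] by auto
    then show ?thesis using 4 unfolding plan_def by (auto intro!: arg_cong[of _ _ concat] map_cong)
  qed (simp add: plan_def)
qed

lemma out_local:
  assumes "agree plan f g (K + 3)"
  shows "out g = out f"
proof -
  have eq: "sel' f a K = sel' g a K" "kept' f a = kept' g a" if "a \<in> set idx" for a
    using sel_local[OF assms that, of K] kept_local[OF assms that] by auto
  have "concat (map (\<lambda>a. [sel' f a K, kept' f a]) idx) = concat (map (\<lambda>a. [sel' g a K, kept' g a]) idx)"
    using eq by (auto intro!: arg_cong[of _ _ concat] map_cong)
  then have cand: "candidates f = candidates g" unfolding candidates_def by simp
  have "f T = g T" if "T \<in> candidates f" for T
  proof -
    have "T \<in> set (plan f 0) \<or> T \<in> set (plan f (K + 2))"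
      using that by (auto simp: candidates_def plan_def)
    then show ?thesis using agreeD[OF assms, of 0 T] agreeD[OF assms, of "K + 2" T] by auto
  qed
  then show ?thesis unfolding out_def cand[symmetric]
    by (intro arg_cong[of _ _ Eps] ext) auto
qed

text \<open>Agreement before round \<open>0\<close> is vacuous, so the initial \<open>g\<close> is
  arbitrary.\<close>

lemma run_plan: "run f (exec plan out (K + 3) 0 g) = return_pmf (out f, map (plan f) [0..<K + 3])"
  by (intro run_exec plan_local out_local) (auto simp: agree_def)

lemma plan_subset:
  assumes "T \<in> set (plan f r)"
  shows "T \<subseteq> N"
proof -
  have "T = {} \<or> (\<exists>a k. T = sel' f a k \<or> T = kept' f a \<or>
      (\<exists>x\<in>N. T \<in> {{x}, insert x (sel' f a k), sel' f a k - {x}, insert x (sel' f a k - {x})}))"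
    using assms unfolding plan_def Let_def
    by (simp add: xs split: if_splits) blast+
  then show ?thesis by (elim disjE exE bexE) (auto simp: sel_iff kept_def)
qed

lemma length_plan:
  assumes "1 \<le> M" "1 \<le> J"
  shows "length (plan f r) \<le> M * J * (2 * length xs + 2)"
proof -
  have MJ: "1 \<le> M * J" using assms by simp
  have len: "length (concat (map F idx)) \<le> M * J * b" if "\<And>a. length (F a) \<le> b" for F :: "_ \<Rightarrow> 'a set list" and b
  proof -
    have "length (concat (map F idx)) = sum_list (map (\<lambda>a. length (F a)) idx)"
      by (simp add: length_concat comp_def)
    also have "\<dots> \<le> sum_list (map (\<lambda>a. b) idx)" using that by (intro sum_list_mono) auto
    also have "\<dots> = M * J * b" by (simp add: sum_list_triv)
    finally show ?thesis .
  qed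
  define b where "b = 2 * length xs + 2"
  have "length (concat (map (\<lambda>x. let T = F x in [T, insert x T]) (filter P xs))) \<le> b" for F P
    using length_filter_le[of P xs]
    by (simp add: b_def length_concat comp_def Let_def sum_list_triv del: length_filter_le)
  note r2 = len[OF this, of "\<lambda>a x. sel' f a (Suc (\<omega> (fst a) x)) - {x}" "\<lambda>a x. \<omega> (fst a) x < K"]
  have r1: "length (concat (map (\<lambda>a. sel' f a (r - 1) # map (\<lambda>x. insert x (sel' f a (r - 1))) xs) idx))
      \<le> M * J * b"
    by (rule len) (simp add: b_def)
  have r3: "length (concat (map (\<lambda>a. [sel' f a K, kept' f a]) idx)) \<le> M * J * b"
    by (rule len) (simp add: b_def)
  have r0: "length ({} # map (\<lambda>x. {x}) xs) \<le> M * J * b"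
    by (rule order_trans[OF _ mult_le_mono1[OF MJ]]) (simp add: b_def)
  show ?thesis
    unfolding plan_def b_def[symmetric] by (auto simp only: r0 r1 r2 r3 split: if_split)
qed

lemma out_candidate:
  assumes "0 < B"
  shows "out f \<in> candidates f" "T \<in> candidates f \<Longrightarrow> f T \<le> f (out f)"
proof -
  have "{} \<in> candidates f" using assms by (auto simp: candidates_def feasible_def)
  moreover have fin: "finite (candidates f)" unfolding candidates_def by (intro finite_Int) auto
  ultimately have "Max (f ` candidates f) \<in> f ` candidates f" by (intro Max_in) auto
  then obtain U where "U \<in> candidates f" "f U = Max (f ` candidates f)" by auto
  then have "\<exists>T. T \<in> candidates f \<and> (\<forall>T' \<in> candidates f. f T' \<le> f T)"
    using fin by (auto intro!: exI[of _ U])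
  from someI_ex[OF this] show "out f \<in> candidates f" "T \<in> candidates f \<Longrightarrow> f T \<le> f (out f)"
    unfolding out_def by auto
qed

end

subsection \<open>The algorithm\<close>

definition log_steps :: "real \<Rightarrow> real \<Rightarrow> nat \<Rightarrow> nat" where
  "log_steps a b n = nat \<lceil>ln (a * real n) / ln b\<rceil>"

lemma log_steps_power:
  assumes "1 \<le> a" "1 < b" "1 \<le> n"
  shows "a * real n \<le> b ^ log_steps a b n"
proof -
  have "1 * 1 \<le> a * real n" using assms by (intro mult_mono) auto
  then have pos: "0 < a * real n" by simp
  have "ln (a * real n) / ln b \<le> real (log_steps a b n)"
    unfolding log_steps_def by linarith
  then have "ln (a * real n) \<le> real (log_steps a b n) * ln b"
    using assms by (simp add: divide_le_eq)
  then have "exp (ln (a * real n)) \<le> exp (real (log_steps a b n) * ln b)" by simp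
  also have "\<dots> = b ^ log_steps a b n"
    using assms by (simp add: exp_of_nat_mult)
  finally show ?thesis using pos by simp
qed

lemma ln_ge_half:
  assumes "2 \<le> n"
  shows "1/2 \<le> ln (real n)"
proof -
  have "ln 2 \<le> ln (real n)" using assms by simp
  then show ?thesis using ln2_ge_two_thirds by linarith
qed

text \<open>The \<open>4\<close> accounts for the \<open>Suc\<close> in \<open>epochs\<close> and
  the three rounds besides the epochs.\<close>

lemma log_steps_bound:
  assumes "1 \<le> a" "1 < b"
  shows "\<exists>C>0. \<forall>n\<ge>2. real (log_steps a b n) + 4 \<le> C * ln (real n)"
\<comment> \<open>As \<open>1/2 \<le> ln n\<close>, \<open>ln a\<close> is at most
  \<open>2 * ln a * ln n\<close>, and rounding up plus \<open>4\<close> costs at most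
  \<open>5 \<le> 10 * ln n\<close>.\<close>
proof (intro exI[of _ "(2 * ln a + 1) / ln b + 10"] conjI allI impI)
  have lns: "0 \<le> ln a" "0 < ln b" using assms by auto
  then show "0 < (2 * ln a + 1) / ln b + 10" by (intro add_nonneg_pos) auto
  fix n :: nat assume "2 \<le> n"
  then have L: "1/2 \<le> ln (real n)" by (rule ln_ge_half)
  have "ln (a * real n) = ln a + ln (real n)" using assms \<open>2 \<le> n\<close> by (intro ln_mult_pos) auto
  also have "ln a \<le> 2 * ln a * ln (real n)"
    using mult_left_mono[OF L, of "2 * ln a"] lns by simp
  finally have "ln (a * real n) \<le> (2 * ln a + 1) * ln (real n)" by (simp add: algebra_simps)
  then have 1: "ln (a * real n) / ln b \<le> (2 * ln a + 1) * ln (real n) / ln b"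
    using lns by (intro divide_right_mono) auto
  moreover have "0 \<le> (2 * ln a + 1) * ln (real n) / ln b" using lns L by auto
  ultimately have "real (log_steps a b n) \<le> (2 * ln a + 1) * ln (real n) / ln b + 1"
    unfolding log_steps_def by linarith
  then show "real (log_steps a b n) + 4 \<le> ((2 * ln a + 1) / ln b + 10) * ln (real n)"
    using L by (simp add: algebra_simps)
qed

definition enum :: "'a set \<Rightarrow> 'a list" where
  "enum N = (SOME xs. set xs = N \<and> distinct xs)"

lemma enum: "finite N \<Longrightarrow> set (enum N) = N \<and> distinct (enum N)"
  unfolding enum_def by (rule someI_ex) (rule finite_distinct_list)

text \<open>This many epochs push the mass of epoch \<open>0\<close> in \<open>epoch_pmf\<close>
  below \<open>1 / (1000 * n)\<close>.\<close>

abbreviation "epochs n \<equiv> Suc (log_steps 1000 (1001/1000) n)"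
text \<open>The grid spans a factor of at least \<open>4 * n\<close>, enough for optima up to
  \<open>n * top_value\<close>.\<close>

abbreviation "guesses n \<equiv> Suc (log_steps 4 (5/4) n)"

definition epoch_dist :: "nat \<Rightarrow> nat pmf" where
  "epoch_dist n = mix_pmf (1/3) (epoch_pmf (1/1000) (log_steps 1000 (1001/1000) n)) (epochs n)"

definition seeds :: "'a set \<Rightarrow> (nat \<Rightarrow> 'a \<Rightarrow> nat) pmf" where
  "seeds N = Pi_pmf {..<128} (\<lambda>_. 0)
     (\<lambda>_. Pi_pmf N (epochs (card N)) (\<lambda>_. epoch_dist (card N)))"

abbreviation "the_plan N c B \<equiv>
  schedule.plan N c B (enum N) 128 (guesses (card N)) (epochs (card N))"
abbreviation "the_out N c B \<equiv>
  schedule.out N c B (enum N) 128 (guesses (card N)) (epochs (card N))"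

text \<open>All coins are tossed before the first query; given the seeds, what remains is a
  deterministic adaptive plan.\<close>

definition knapsack_alg :: "'a set \<Rightarrow> ('a \<Rightarrow> real) \<Rightarrow> real \<Rightarrow> 'a oracle_alg" where
  "knapsack_alg N c B = Toss (map_pmf
     (\<lambda>\<omega>. exec (the_plan N c B \<omega>) (the_out N c B \<omega>) (epochs (card N) + 3) 0 (\<lambda>_. 0)) (seeds N))"

lemma schedule_enum: "finite N \<Longrightarrow> schedule N (enum N)"
  by (simp add: schedule_def enum)

lemma run_knapsack_alg:
  assumes "finite N"
  shows "run f (knapsack_alg N c B) = map_pmf
    (\<lambda>\<omega>. (the_out N c B \<omega> f, map (the_plan N c B \<omega> f) [0..<epochs (card N) + 3])) (seeds N)"
proof -
  have "run f (knapsack_alg N c B) = bind_pmf (seeds N) (\<lambda>\<omega>. return_pmf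
      (the_out N c B \<omega> f, map (the_plan N c B \<omega> f) [0..<epochs (card N) + 3]))"
    unfolding knapsack_alg_def run.simps pmf.map_comp comp_def
      schedule.run_plan[OF schedule_enum[OF assms]]
    by (simp add: bind_eq_join_pmf)
  then show ?thesis by (simp add: map_pmf_def)
qed

text \<open>Below \<open>epochs n\<close> the distribution is a third of \<open>epoch_pmf\<close>,
  so the step inequality is inherited.\<close>

lemma epoch_dist:
  assumes "1 \<le> n"
  shows "set_pmf (epoch_dist n) \<subseteq> {..epochs n}" "pmf (epoch_dist n) (epochs n) = 1 - 1/3"
    and "k < epochs n \<Longrightarrow> pmf (epoch_dist n) k
           \<le> 1/1000 * measure_pmf.prob (epoch_dist n) {..<k} + 1/1000 / real n"
proof -
  define m where "m = log_steps 1000 (1001/1000) n"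
  let ?e = "1/1000 :: real"
  let ?D = "epoch_pmf ?e m"
  have D: "epoch_dist n = mix_pmf (1/3) ?D (Suc m)" "epochs n = Suc m"
    by (simp_all add: epoch_dist_def m_def)
  have prob: "measure_pmf.prob (epoch_dist n) A
      = 1/3 * measure_pmf.prob ?D A + (1 - 1/3) * indicator A (Suc m)" for A
    unfolding D by (rule prob_mix_pmf) auto
  show "set_pmf (epoch_dist n) \<subseteq> {..epochs n}"
    using set_mix_pmf[of "1/3" ?D "Suc m"] set_epoch_pmf[of ?e m] unfolding D by auto
  have "pmf ?D (Suc m) = 0" using set_epoch_pmf[of ?e m] by (auto simp: set_pmf_eq)
  then show "pmf (epoch_dist n) (epochs n) = 1 - 1/3"
    using prob[of "{Suc m}"] D(2) by (simp add: measure_pmf_single)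
  assume k: "k < epochs n"
  have "1000 * real n \<le> (1001/1000) ^ m" unfolding m_def using assms by (intro log_steps_power) auto
  then have r: "(1 / (1 + ?e)) ^ m \<le> 1/1000 / real n"
    using assms by (simp add: power_divide field_simps)
  have "pmf (epoch_dist n) k = 1/3 * pmf ?D k"
    using prob[of "{k}"] k D(2) by (simp add: measure_pmf_single)
  also have "\<dots> \<le> 1/3 * (?e * measure_pmf.prob ?D {..<k} + (1 / (1 + ?e)) ^ m)"
    using k D(2) by (intro mult_left_mono epoch_pmf_step) auto
  also have "\<dots> \<le> 1/3 * (?e * measure_pmf.prob ?D {..<k}) + 1/1000 / real n"
    using r divide_nonneg_nonneg[of "1/1000" "real n"] by (simp only: distrib_left) linarith
  also have "1/3 * (?e * measure_pmf.prob ?D {..<k}) = ?e * measure_pmf.prob (epoch_dist n) {..<k}"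
    using prob[of "{..<k}"] k D(2) by simp
  finally show "pmf (epoch_dist n) k
           \<le> 1/1000 * measure_pmf.prob (epoch_dist n) {..<k} + 1/1000 / real n" .
qed

subsection \<open>The approximation guarantee\<close>

text \<open>
  With \<open>v\<close> the costliest element of \<open>V\<close> and \<open>w\<close> the second one, \<open>\<Gamma> = B - c w\<close> bounds both the
  cost of \<open>V - {v}\<close> and the cost up to which every element of \<open>V - {v}\<close> fits.
\<close>
lemma costliest_element:
  assumes "finite V" "V \<noteq> {}" "sum c V \<le> B" "0 < B" "\<And>x. x \<in> V \<Longrightarrow> 0 < (c x :: real)"
  obtains v \<Gamma> where "v \<in> V" "sum c (V - {v}) \<le> \<Gamma>" "\<And>x. x \<in> V - {v} \<Longrightarrow> c x + \<Gamma> \<le> B"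
    "B / 2 \<le> \<Gamma>" "\<Gamma> \<le> B"
proof -
  have ex: "\<exists>v\<in>A. \<forall>x\<in>A. c x \<le> c v" if "finite A" "A \<noteq> {}" for A
  proof -
    have "Max (c ` A) \<in> c ` A" using that by (intro Max_in) auto
    then obtain v where "v \<in> A" "c v = Max (c ` A)" by auto
    then show ?thesis using that by (intro bexI[of _ v]) auto
  qed
  obtain v where v: "v \<in> V" "\<And>x. x \<in> V \<Longrightarrow> c x \<le> c v" using ex[of V] assms by auto
  have sumV: "sum c V = c v + sum c (V - {v})" using assms v by (simp add: sum.remove)
  show ?thesis
  proof (cases "V - {v} = {}")
    case True
    then have "sum c (V - {v}) = 0" by (simp only: sum.empty)
    with True show ?thesis using v(1) assms(4) by (intro that[of v B]) auto
  next
    case False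
    obtain w where w: "w \<in> V - {v}" "\<And>x. x \<in> V - {v} \<Longrightarrow> c x \<le> c w"
      using ex[of "V - {v}"] False assms by auto
    have "c w \<le> sum c (V - {v})"
      using w assms by (intro member_le_sum) (auto intro: less_imp_le)
    show ?thesis
    proof (rule that[of v "B - c w"])
      show "sum c (V - {v}) \<le> B - c w" using sumV assms(3) v(2)[of w] w(1) by auto
      \<comment> \<open>\<open>c w \<le> c v\<close> and \<open>c v + c w \<le> B\<close> give
        \<open>c w \<le> B / 2\<close>.\<close>
      show "B / 2 \<le> B - c w" using \<open>c w \<le> _\<close> sumV assms(3) v(2)[of w] w(1) by auto
      show "B - c w \<le> B" using assms(5)[of w] w(1) by auto
      show "c x + (B - c w) \<le> B" if "x \<in> V - {v}" for x using w(2)[OF that] by simp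
    qed (rule v(1))
  qed
qed

lemma top_value_bounds:
  assumes "finite N"
  shows "f {} \<le> top_value N f" "x \<in> N \<Longrightarrow> f {x} \<le> top_value N f"
    and "top_value N f = f {} \<or> (\<exists>x\<in>N. top_value N f = f {x})"
proof -
  show "f {} \<le> top_value N f" "x \<in> N \<Longrightarrow> f {x} \<le> top_value N f"
    unfolding top_value_def using assms by auto
  have "top_value N f \<in> insert (f {}) ((\<lambda>x. f {x}) ` N)"
    unfolding top_value_def using assms by (intro Max_in) auto
  then show "top_value N f = f {} \<or> (\<exists>x\<in>N. top_value N f = f {x})" by auto
qed

text \<open>Submodularity bounds \<open>f V\<close> by the singleton values minus
  \<open>card V - 1\<close> copies of \<open>f {}\<close>, which are nonnegative because
  \<open>V\<close> is nonempty.\<close>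

lemma value_le_top_value:
  assumes inst: "knapsack_instance N c B f" and V: "V \<subseteq> N" "V \<noteq> {}"
  shows "f V \<le> real (card N) * top_value N f"
proof -
  interpret knapsack_process N c B f 0 0 by unfold_locales (use inst in auto)
  have finV: "finite V" using V fin_sub by auto
  have "f V - f {} \<le> (\<Sum>x\<in>V. f {x} - f {})"
    using submodular_union_upper[OF submod finV V(1), of "{}"] by simp
  also have "\<dots> \<le> (\<Sum>x\<in>V. top_value N f - f {})"
    using V top_value_bounds(2)[OF finN] by (intro sum_mono) auto
  also have "\<dots> = real (card V) * top_value N f - real (card V) * f {}"
    by (simp add: algebra_simps)
  finally have "f V \<le> real (card V) * top_value N f - (real (card V) - 1) * f {}"
    by (simp add: algebra_simps)
  moreover have "1 \<le> card V" using finV V by (simp add: Suc_leI card_gt_0_iff)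
  then have "0 \<le> (real (card V) - 1) * f {}" using f_nonneg[of "{}"] by simp
  moreover have "real (card V) * top_value N f \<le> real (card N) * top_value N f"
    using V finN f_nonneg[of "{}"] top_value_bounds(1)[OF finN, of f]
    by (intro mult_right_mono) (auto intro: card_mono)
  ultimately show ?thesis by linarith
qed

text \<open>The least guess reaching \<open>4/25 * v\<close> works: its predecessor lies below, so
  it overshoots by a factor of at most \<open>5/4\<close>.\<close>

lemma good_guess:
  assumes "0 < B" "B / 2 \<le> \<Gamma>" "\<Gamma> \<le> B" "0 < top_value N f" "top_value N f \<le> v"
    and "v \<le> real (card N) * top_value N f"
  obtains j where "j < guesses (card N)" "4/25 * v \<le> threshold N B f j * \<Gamma>"
    "threshold N B f j * \<Gamma> \<le> 1/5 * v"
proof -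
  let ?t = "top_value N f" and ?m = "log_steps 4 (5/4) (card N)"
  let ?a = "\<lambda>j. threshold N B f j * \<Gamma>"
  have "card N \<noteq> 0" using assms by (intro notI) auto
  then have pow: "4 * real (card N) \<le> (5/4) ^ ?m" by (intro log_steps_power) auto
  have "4/25 * v \<le> 1/5 * (real (card N) * ?t)" using assms by simp
  also have "\<dots> = ?t / (10 * B) * (4 * real (card N)) * (B / 2)" using assms by simp
  also have "\<dots> \<le> ?a ?m"
    unfolding threshold_def using assms pow by (intro mult_mono mult_left_mono) auto
  finally have m: "4/25 * v \<le> ?a ?m" .
  define j where "j = (LEAST j. 4/25 * v \<le> ?a j)"
  have j: "4/25 * v \<le> ?a j" unfolding j_def by (rule LeastI[of _ ?m]) (rule m)
  have "j \<le> ?m" unfolding j_def by (rule Least_le) (rule m)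
  \<comment> \<open>Guess \<open>0\<close> is too small, because \<open>1/10 < 4/25\<close>; hence
    \<open>j\<close> has a predecessor.\<close>
  have "?a 0 = ?t * (\<Gamma> / (10 * B))" by (simp add: threshold_def)
  also have "\<dots> \<le> ?t * (1/10)" using assms by (intro mult_left_mono) (auto simp: field_simps)
  also have "\<dots> < 4/25 * v" using assms by simp
  finally have "j \<noteq> 0" using j by (intro notI) simp
  then obtain i where i: "j = Suc i" by (cases j) auto
  have "?a i < 4/25 * v" using not_less_Least[of i "\<lambda>j. 4/25 * v \<le> ?a j"] i
    unfolding j_def[symmetric] by simp
  moreover have "?a j = 5/4 * ?a i" unfolding i by (simp add: threshold_def)
  ultimately have "?a j \<le> 1/5 * v" by linarith
  then show ?thesis using that[of j] j \<open>j \<le> ?m\<close> by simp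
qed

lemma the_out:
  assumes "knapsack_instance N c B f"
  shows "feasible N c B (the_out N c B \<omega> f)"
    and "f {} \<le> f (the_out N c B \<omega> f)" and "x \<in> N \<Longrightarrow> f {x} \<le> f (the_out N c B \<omega> f)"
    and "i < 128 \<Longrightarrow> j < guesses (card N) \<Longrightarrow>
      T \<in> {sel N c B f (threshold N B f j) (\<omega> i) (epochs (card N)),
           kept N c B f (threshold N B f j) (epochs (card N)) (\<omega> i)} \<Longrightarrow>
      feasible N c B T \<Longrightarrow> f T \<le> f (the_out N c B \<omega> f)"
proof -
  have B: "0 < B" and finN: "finite N" and c: "\<And>x. x \<in> N \<Longrightarrow> c x \<le> B"
    using assms by (auto simp: knapsack_instance_def)
  interpret schedule N c B "enum N" 128 "guesses (card N)" "epochs (card N)" \<omega>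
    by (rule schedule_enum[OF finN])
  show "feasible N c B (out f)" using out_candidate(1)[OF B, of f] by (simp add: candidates_def)
  show "f {} \<le> f (out f)"
    using B by (intro out_candidate(2)) (auto simp: candidates_def feasible_def)
  show "f {x} \<le> f (out f)" if "x \<in> N" 
    using B c[of x] that xs by (intro out_candidate(2)) (auto simp: candidates_def feasible_def)
  show "f T \<le> f (out f)" if "i < 128" "j < guesses (card N)"
      "T \<in> {sel N c B f (threshold N B f j) (\<omega> i) (epochs (card N)),
            kept N c B f (threshold N B f j) (epochs (card N)) (\<omega> i)}" "feasible N c B T"
  proof (rule out_candidate(2)[OF B])
    have "(i, j) \<in> set idx" using that by auto
    then have "T \<in> (\<Union>a\<in>set idx. {sel' f a (epochs (card N)), kept' f a})"
      using that(3) by (intro UN_I) auto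
    then show "T \<in> candidates f" using that(4) by (auto simp: candidates_def)
  qed
qed

lemma OPT_attained:
  assumes "knapsack_instance N c B f"
  obtains V where "feasible N c B V" "OPT N c B f = f V" "\<And>T. feasible N c B T \<Longrightarrow> f T \<le> f V"
proof -
  have fin: "finite {T. feasible N c B T}"
    by (rule finite_subset[of _ "Pow N"]) (use assms in \<open>auto simp: feasible_def knapsack_instance_def\<close>)
  have "feasible N c B {}" using assms by (simp add: feasible_def knapsack_instance_def)
  then have ne: "{T. feasible N c B T} \<noteq> {}" by blast
  have le: "f T \<le> OPT N c B f" if "feasible N c B T" for T
    unfolding OPT_def using fin that by (intro Max_ge) auto
  have "OPT N c B f \<in> f ` {T. feasible N c B T}"
    unfolding OPT_def using fin ne by (intro Max_in) auto
  then obtain V where "feasible N c B V" "OPT N c B f = f V" by auto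
  with le show ?thesis using that by metis
qed

lemma finite_seeds: "finite N \<Longrightarrow> finite (set_pmf (seeds N))"
  unfolding seeds_def epoch_dist_def
  by (auto simp: set_Pi_pmf intro!: finite_PiE_dflt finite_subset[OF set_mix_pmf]
      finite_subset[OF set_epoch_pmf])

lemma expected_value:
  assumes inst: "knapsack_instance N c B f"
  shows "OPT N c B f \<le> 9.465 * measure_pmf.expectation (seeds N) (\<lambda>\<omega>. f (the_out N c B \<omega> f))"
proof -
  interpret I: knapsack_process N c B f 0 0 by unfold_locales (use inst in auto)
  note Z = the_out[OF inst]
  let ?Z = "\<lambda>\<omega>. f (the_out N c B \<omega> f)" and ?n = "card N"
  let ?E = "measure_pmf.expectation (seeds N)"
  have const: "a \<le> ?E ?Z" if "\<And>\<omega>. a \<le> ?Z \<omega>" for a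
    using integral_mono[of "seeds N" "\<lambda>_. a" ?Z] that
    by (simp add: integrable_measure_pmf_finite finite_seeds I.finN)
  have E_ge: "f {} \<le> ?E ?Z" using Z(2) by (intro const)
  have E_nonneg: "0 \<le> ?E ?Z" using E_ge I.f_nonneg[of "{}"] by simp
  obtain V where V: "feasible N c B V" "OPT N c B f = f V" "\<And>T. feasible N c B T \<Longrightarrow> f T \<le> f V"
    by (rule OPT_attained[OF inst]) (rule that, assumption+)
  have VN: "V \<subseteq> N" "sum c V \<le> B" using V(1) by (auto simp: feasible_def)
  show ?thesis
  \<comment> \<open>The output is at least as good as the empty set, which settles an empty optimum;
    afterwards \<open>f V\<close> is positive and some threshold fits.\<close>
  proof (cases "V = {} \<or> f V = 0")
    case True
    then show ?thesis using V(2) E_ge E_nonneg by auto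
  next
    case False
    then have "V \<noteq> {}" "0 < f V" using I.f_nonneg[OF VN(1)] by auto
    have finV: "finite V" using I.fin_sub[OF VN(1)] .
    obtain v \<Gamma> where v: "v \<in> V" "sum c (V - {v}) \<le> \<Gamma>" "\<And>x. x \<in> V - {v} \<Longrightarrow> c x + \<Gamma> \<le> B"
        "B / 2 \<le> \<Gamma>" "\<Gamma> \<le> B"
    proof (rule costliest_element[OF finV \<open>V \<noteq> {}\<close> VN(2) I.B_pos])
      show "0 < c x" if "x \<in> V" for x using that VN I.c_pos by auto
    qed (rule that, assumption+)
    have upper: "f V \<le> real ?n * top_value N f"
      by (rule value_le_top_value[OF inst VN(1) \<open>V \<noteq> {}\<close>])
    have "feasible N c B {}" "\<And>x. x \<in> N \<Longrightarrow> feasible N c B {x}"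
      using I.B_pos I.c_le by (auto simp: feasible_def)
    then have lower: "top_value N f \<le> f V"
      using top_value_bounds(3)[OF I.finN, of f] V(3) by auto
    have "0 < top_value N f"
    proof (rule ccontr)
      assume "\<not> 0 < top_value N f"
      then have "real ?n * top_value N f \<le> 0" by (intro mult_nonneg_nonpos) auto
      then show False using upper \<open>0 < f V\<close> by linarith
    qed
    then obtain j where j: "j < guesses ?n" "4/25 * f V \<le> threshold N B f j * \<Gamma>"
        "threshold N B f j * \<Gamma> \<le> 1/5 * f V"
      by (rule good_guess[OF I.B_pos v(4,5) _ lower upper])
    have n: "1 \<le> ?n" using \<open>V \<noteq> {}\<close> VN(1) I.finN by (auto simp: Suc_le_eq card_gt_0_iff)
    have \<tau>: "0 \<le> threshold N B f j"
      using \<open>0 < top_value N f\<close> I.B_pos by (simp add: threshold_def)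
    interpret epoch_process N c B f "threshold N B f j" "epochs ?n" "epoch_dist ?n" "1/3" "1/1000" "1/1000"
      by unfold_locales (use inst \<tau> epoch_dist[OF n] in auto)
    have "f V \<le> 9.465 * measure_pmf.expectation (Pi_pmf {..<128} (\<lambda>_. 0) (\<lambda>_. P)) ?Z"
    proof (rule repeated_value[OF refl refl refl VN(1) v j(2,3)])
      show "f {v} \<le> ?Z \<omega>" for \<omega> using v(1) VN(1) by (intro Z(3)) auto
      show "f (G (\<omega> i)) \<le> ?Z \<omega>" if "i < 128" for \<omega> i
        using kept_feasible by (intro Z(4)[OF that j(1)]) auto
      show "f (S (\<omega> i) (epochs ?n)) \<le> ?Z \<omega>"
        if "i < 128" "sum c (S (\<omega> i) (epochs ?n)) \<le> B" for \<omega> i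
        using that(2) by (intro Z(4)[OF that(1) j(1)]) (auto simp: feasible_def sel_iff)
    qed
    then show ?thesis using V(2) by (simp add: seeds_def P_def)
  qed
qed


section \<open>Comparing the cost of the algorithm with the claimed bounds\<close>

lemma rounds_bound:
  fixes n :: nat
  assumes "2 \<le> n" "0 < \<epsilon>" "\<epsilon> < 1/3" "0 < C" "C \<le> C'" "r \<le> C * ln (real n)"
  shows "r \<le> C' * (1 / \<epsilon> * (ln (real n))\<^sup>2)"
proof -
  let ?L = "ln (real n)"
  have L: "1/2 \<le> ?L" by (rule ln_ge_half[OF assms(1)])
  \<comment> \<open>The extra factors \<open>1 / \<epsilon>\<close> and \<open>ln n\<close> of the
    target have a product of at least \<open>3/2\<close>.\<close>
  have "3 \<le> 1 / \<epsilon>" using assms by (simp add: field_simps)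
  then have "3 * ?L\<^sup>2 \<le> 1 / \<epsilon> * ?L\<^sup>2" by (intro mult_right_mono) auto
  moreover have "?L \<le> 3 * ?L\<^sup>2" using mult_right_mono[OF L, of ?L] L by (simp add: power2_eq_square)
  ultimately have "?L \<le> 1 / \<epsilon> * ?L\<^sup>2" by linarith
  then have "C * ?L \<le> C' * (1 / \<epsilon> * ?L\<^sup>2)" using assms L by (intro mult_mono) auto
  then show ?thesis using assms(6) by linarith
qed

text \<open>The extra factor \<open>1 / \<epsilon> ^ 3\<close> exceeds \<open>2\<close>, the extra
  \<open>ln n\<close> is at least \<open>1/2\<close>, and \<open>ln (1 / \<epsilon>)\<close> is at
  least \<open>1\<close>, since \<open>1 / \<epsilon>\<close> exceeds Euler's number.\<close>

lemma queries_bound: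
  fixes n :: nat
  assumes "2 \<le> n" "0 < \<epsilon>" "\<epsilon> < 1/3" "0 < C" "C \<le> C'" "r \<le> C * (real n * (ln (real n))\<^sup>2)"
  shows "r \<le> C' * (real n / \<epsilon> ^ 3 * (ln (real n)) ^ 3 * ln (1 / \<epsilon>))"
proof -
  let ?L = "ln (real n)"
  have L: "1/2 \<le> ?L" by (rule ln_ge_half[OF assms(1)])
  have inv: "3 \<le> 1 / \<epsilon>" using assms by (simp add: field_simps)
  have "exp 1 \<le> (3::real)" using e_less_272 by simp
  also have "\<dots> \<le> 1 / \<epsilon>" by (rule inv)
  finally have l1: "1 \<le> ln (1 / \<epsilon>)" using assms by (simp add: ln_ge_iff)
  have "3 ^ 3 \<le> (1 / \<epsilon>) ^ 3" using inv by (intro power_mono) auto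
  then have e3: "2 \<le> 1 / \<epsilon> ^ 3" by (simp add: power_divide)
  have "real n * ?L\<^sup>2 = real n * 2 * (?L\<^sup>2 * (1/2)) * 1" by simp
  also have "\<dots> \<le> real n * (1 / \<epsilon> ^ 3) * (?L\<^sup>2 * ?L) * ln (1 / \<epsilon>)"
    using e3 L l1 assms by (intro mult_mono mult_left_mono mult_nonneg_nonneg) auto
  also have "\<dots> = real n / \<epsilon> ^ 3 * ?L ^ 3 * ln (1 / \<epsilon>)"
    by (simp add: power2_eq_square power3_eq_cube)
  finally have le: "real n * ?L\<^sup>2 \<le> real n / \<epsilon> ^ 3 * ?L ^ 3 * ln (1 / \<epsilon>)" .
  have "C * (real n * ?L\<^sup>2) \<le> C' * (real n / \<epsilon> ^ 3 * ?L ^ 3 * ln (1 / \<epsilon>))"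
    by (rule mult_mono[OF assms(5) le]) (use assms in auto)
  then show ?thesis using assms(6) by linarith
qed

lemma value_queries_the_plan:
  assumes "finite N"
  shows "value_queries (map (the_plan N c B \<omega> f) [0..<t])
    \<le> t * (128 * guesses (card N) * (2 * card N + 2))"
proof -
  have "length (enum N) = card N" using enum[OF assms] distinct_card by metis
  then have "length (the_plan N c B \<omega> f r) \<le> 128 * guesses (card N) * (2 * card N + 2)" for r
    using schedule.length_plan[OF schedule_enum[OF assms], of 128 "guesses (card N)" c B "epochs (card N)" \<omega> f r]
    by simp
  then have "sum_list (map (\<lambda>r. length (the_plan N c B \<omega> f r)) [0..<t])
      \<le> sum_list (map (\<lambda>r. 128 * guesses (card N) * (2 * card N + 2)) [0..<t])"
    by (intro sum_list_mono) auto
  then show ?thesis by (simp add: value_queries_def comp_def sum_list_triv)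
qed

theorem theorem2:
  "\<exists>C::real. 0 < C \<and>
     (\<forall>\<epsilon>::real. 0 < \<epsilon> \<and> \<epsilon> < 1/3 \<longrightarrow>
       (\<exists>alg :: 'a set \<Rightarrow> ('a \<Rightarrow> real) \<Rightarrow> real \<Rightarrow> 'a oracle_alg.
          \<forall>N c B f. knapsack_instance N c B f \<longrightarrow>
            approximates (9.465 + \<epsilon>) N c B f (alg N c B) \<and>
            (\<forall>(S, tr) \<in> set_pmf (run f (alg N c B)).
               valid_transcript N tr \<and>
               (2 \<le> card N \<longrightarrow>
                  real (adaptive_rounds tr) \<le> C * (1 / \<epsilon> * (ln (real (card N)))\<^sup>2) \<and>
                  real (value_queries tr) \<le>
                    C * (real (card N) / \<epsilon> ^ 3 * (ln (real (card N))) ^ 3 * ln (1 / \<epsilon>))))))"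
proof -
  obtain C1 where C1: "0 < C1"
      "\<And>n. 2 \<le> n \<Longrightarrow> real (log_steps 1000 (1001/1000) n) + 4 \<le> C1 * ln (real n)"
    using log_steps_bound[of 1000 "1001/1000"] by auto
  obtain C2 where C2: "0 < C2"
      "\<And>n. 2 \<le> n \<Longrightarrow> real (log_steps 4 (5/4) n) + 4 \<le> C2 * ln (real n)"
    using log_steps_bound[of 4 "5/4"] by auto
  \<comment> \<open>\<open>C1\<close> serves the rounds and \<open>512 * C1 * C2\<close> the
    queries; neither depends on \<open>\<epsilon>\<close>.\<close>
  define C where "C = C1 + 512 * C1 * C2"
  have C: "0 < C" "C1 \<le> C" "0 < 512 * C1 * C2" "512 * C1 * C2 \<le> C"
    using C1 C2 by (auto simp: C_def add_pos_pos)
  have main: "approximates (9.465 + \<epsilon>) N c B f (knapsack_alg N c B) \<and>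
      (\<forall>(S, tr) \<in> set_pmf (run f (knapsack_alg N c B)).
         valid_transcript N tr \<and>
         (2 \<le> card N \<longrightarrow>
            real (adaptive_rounds tr) \<le> C * (1 / \<epsilon> * (ln (real (card N)))\<^sup>2) \<and>
            real (value_queries tr) \<le>
              C * (real (card N) / \<epsilon> ^ 3 * (ln (real (card N))) ^ 3 * ln (1 / \<epsilon>))))"
    if eps: "0 < \<epsilon>" "\<epsilon> < 1/3" and inst: "knapsack_instance N c B f"
    for \<epsilon> and N :: "'a set" and c B f
  proof -
    have finN: "finite N" using inst by (simp add: knapsack_instance_def)
    note run = run_knapsack_alg[OF finN, of f c B]
    let ?n = "card N" and ?t = "epochs (card N) + 3"
    let ?E = "measure_pmf.expectation (seeds N) (\<lambda>\<omega>. f (the_out N c B \<omega> f))"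
    have "0 \<le> f (the_out N c B \<omega> f)" for \<omega>
      using the_out(1)[OF inst, of \<omega>] inst by (simp add: feasible_def knapsack_instance_def)
    then have "0 \<le> ?E" by (intro integral_nonneg_AE) auto
    \<comment> \<open>The ratio \<open>9.465\<close> already holds, and the summand with
      \<open>\<epsilon>\<close> only adds a nonnegative amount.\<close>
    then have "OPT N c B f \<le> (9.465 + \<epsilon>) * ?E"
      using expected_value[OF inst] mult_nonneg_nonneg[OF less_imp_le[OF eps(1)], of ?E]
      unfolding distrib_right by linarith
    then have approx: "approximates (9.465 + \<epsilon>) N c B f (knapsack_alg N c B)"
      using the_out(1)[OF inst] unfolding approximates_def run by auto
    have bounds: "valid_transcript N tr \<and>
         (2 \<le> ?n \<longrightarrow>
            real (adaptive_rounds tr) \<le> C * (1 / \<epsilon> * (ln (real ?n))\<^sup>2) \<and>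
            real (value_queries tr) \<le>
              C * (real ?n / \<epsilon> ^ 3 * (ln (real ?n)) ^ 3 * ln (1 / \<epsilon>)))"
      if tr: "tr = map (the_plan N c B \<omega> f) [0..<?t]" for tr \<omega>
    proof (intro conjI impI)
      show "valid_transcript N tr"
        using schedule.plan_subset[OF schedule_enum[OF finN]]
        unfolding tr valid_transcript_def by fastforce
      assume n: "2 \<le> ?n"
      let ?L = "ln (real ?n)"
      have L: "1/2 \<le> ?L" by (rule ln_ge_half[OF n])
      have t: "real ?t \<le> C1 * ?L" using C1(2)[OF n] by simp
      have g: "real (guesses ?n) \<le> C2 * ?L" using C2(2)[OF n] by simp
      show "real (adaptive_rounds tr) \<le> C * (1 / \<epsilon> * ?L\<^sup>2)"
        using rounds_bound[OF n eps C1(1) C(2) t] by (simp add: tr adaptive_rounds_def)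
      have "real (value_queries tr) \<le> real (?t * (128 * guesses ?n * (2 * ?n + 2)))"
        unfolding tr by (intro of_nat_mono value_queries_the_plan finN)
      also have "\<dots> = real ?t * (128 * real (guesses ?n) * (2 * real ?n + 2))"
        by (simp only: of_nat_mult of_nat_add of_nat_numeral)
      \<comment> \<open>\<open>2 * n + 2 \<le> 4 * n\<close>, and \<open>128 * 4\<close> is the
        constant \<open>512\<close>.\<close>
      also have "\<dots> \<le> (C1 * ?L) * (128 * (C2 * ?L) * (4 * real ?n))"
        using t g n C1(1) C2(1) L by (intro mult_mono mult_nonneg_nonneg) auto
      also have "\<dots> = (512 * C1 * C2) * (real ?n * ?L\<^sup>2)" by (simp add: power2_eq_square)
      finally show "real (value_queries tr) \<le>
          C * (real ?n / \<epsilon> ^ 3 * ?L ^ 3 * ln (1 / \<epsilon>))"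
        by (rule queries_bound[OF n eps C(3,4)])
    qed
    have "\<forall>(S, tr) \<in> set_pmf (run f (knapsack_alg N c B)).
        valid_transcript N tr \<and>
        (2 \<le> ?n \<longrightarrow>
            real (adaptive_rounds tr) \<le> C * (1 / \<epsilon> * (ln (real ?n))\<^sup>2) \<and>
            real (value_queries tr) \<le>
              C * (real ?n / \<epsilon> ^ 3 * (ln (real ?n)) ^ 3 * ln (1 / \<epsilon>)))"
      unfolding run set_map_pmf using bounds[OF refl] by blast
    with approx show ?thesis by blast
  qed
  show ?thesis
    by (intro exI[of _ C] conjI C(1) allI impI exI[of _ knapsack_alg]) (use main in auto)
qed

end
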